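(* Let $\gamma,\gamma'>0$, and for suitable $f$ on $L(\gamma)$ put $$(\mathcal F_\gamma f)(y):=\int_\gamma E_q(iqxy)f(x)\,d_qx,\qquad(\tilde{\mathcal F}_\gamma f)(y):=\sum_{k=0}^\infty\mu_{k,\gamma}(f)\frac{(iy)^k}{(q;q)_k}\qquad(y\in\mathbf C).$$ (a) If $f\in\mathcal I_\gamma^{\omega}$ then $\tilde{\mathcal F}_\gamma f$ is well-defined and it is an entire analytic function. (b) If moreover $f\in\mathcal I_\gamma^{\rm s\omega}$ then $\mathcal F_\gamma f$ is also well-defined and $\mathcal F_\gamma f=\tilde{\mathcal F}_\gamma f$. (c) Let $f\in\mathcal I_\gamma^{\omega}$. Then $\tilde{\mathcal F}_\gamma f=0$ if and only if $\mu_{k,\gamma}(f)=0$ for all $k\in\mathbf Z_{\ge0}$. (d) Let $f\in\mathcal H^{\rm S}\mathcal I_{\gamma,>1/2}^{\rm s\omega}$. Then $\mathcal F_\gamma f=0$ if and only if $f=0$. (e) Let $f\in\mathcal H^{\rm D}\mathcal I_\gamma^{\omega}$ and $g\in\mathcal H^{\rm D}\mathcal I_{\gamma'}^{\omega}$. Then $f*_\gamma g\in\mathcal H^{\rm D}\mathcal I_{\gamma'}^{\omega}$ and $\tilde{\mathcal F}_{\gamma'}(f*_\gamma g)=(\tilde{\mathcal F}_\gamma f)(\tilde{\mathcal F}_{\gamma'}g)$.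
   Context: Fix $0<q<1$. $(a;q)_k=\prod_{j=0}^{k-1}(1-aq^j)$, $[e]_q!=(q;q)_e/(1-q)^e$, $E_q(x)=\sum_{k\ge0}\frac{q^{k(k-1)/2}x^k}{(q;q)_k}=\prod_{j\ge0}(1+xq^j)$. The $q$-derivative is $(\partial f)(x)=\frac{f(x)-f(qx)}{(1-q)x}$ for $x\ne0$; for functions holomorphic near $0$ its value at $0$ is given by analytic continuation. For $\gamma>0$ let $L(\gamma)=\{\pm q^k\gamma\mid k\in\mathbf Z\}$ and $\int_\gamma f=\int_\gamma f(x)\,d_qx=(1-q)\sum_{k\in\mathbf Z}\sum_{\epsilon=\pm1}q^k\gamma f(\epsilon q^k\gamma)$ when the sum converges absolutely. $\mathcal I_\gamma^\infty$ is the space of functions $f$ on $L(\gamma)$ such that for all $e\in\mathbf Z_{\ge0}$ this sum converges absolutely for $x\mapsto f(x)x^e$. For $f\in\mathcal I_\gamma^\infty$: $\mu_{e,\gamma}(f)=q^{(e^2+e)/2}\int_\gamma f(x)x^e$ and $\nu_{e,\gamma}(f)=q^{(e^2+e)/2}\int_\gamma|f(x)x^e|$. $q$-convolution: $(f*_\gamma g)(x)=\sum_{e=0}^\infty\frac{(-1)^e\mu_{e,\gamma}(f)}{[e]_q!}(\partial^e g)(x)$, at points $x$ where all $(\partial^eg)(x)$ are defined and the series converges absolutely. $\mathcal I_\gamma^{\omega}$ (resp. $\mathcal I_\gamma^{\rm s\omega}$) is the set of $f\in\mathcal I_\gamma^\infty$ such that for some $\alpha,b>0$, $|\mu_{e,\gamma}(f)|$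 (resp. $\nu_{e,\gamma}(f)$) is $O(q^{\alpha e^2/2}b^e)$ as $e\to\infty$. $\mathcal H^{\rm D}\mathcal I_\gamma^{\omega}$: the $f\in\mathcal I_\gamma^{\omega}$ which coincide, at the points of $L(\gamma)$ in some disk centered at $0$, with a function holomorphic on that disk. $\mathcal H^{\rm S}\mathcal I_{\gamma,>1/2}^{\rm s\omega}$: the $f\in\mathcal I_\gamma^\infty$ with $\nu_{e,\gamma}(f)=O(q^{\alpha e^2/2}b^e)$ for some $\alpha\in(1/2,1]$, $b>0$, which are restrictions to $L(\gamma)$ of a function holomorphic on some strip $\{|{\rm Im}(z)|<a\}$, $a>0$. *)

theory Defs
  imports "HOL-Complex_Analysis.Complex_Analysis" "HOL-Library.Landau_Symbols"
begin

definition qpoch :: "real \<Rightarrow> real \<Rightarrow> nat \<Rightarrow> real" where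
  "qpoch a q k = (\<Prod>j<k. 1 - a * q ^ j)"

definition qfact :: "real \<Rightarrow> nat \<Rightarrow> real" where
  "qfact q e = qpoch q q e / (1 - q) ^ e"

definition qExp :: "real \<Rightarrow> complex \<Rightarrow> complex" where
  "qExp q x = (\<Sum>k. of_real (q ^ (k * (k - 1) div 2)) * x ^ k / of_real (qpoch q q k))"

text \<open>At \<open>0\<close> the difference quotient is continued by its limit; this is meaningful
  only for functions holomorphic near \<open>0\<close>.\<close>

definition qderiv :: "real \<Rightarrow> (complex \<Rightarrow> complex) \<Rightarrow> complex \<Rightarrow> complex" where
  "qderiv q f x =
     (let D = (\<lambda>z. (f z - f (of_real q * z)) / (of_real (1 - q) * z))
      in if x = 0 then Lim (at 0) D else D x)"

definition qlattice :: "real \<Rightarrow> real \<Rightarrow> complex set" where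
  "qlattice q \<gamma> = {of_real (s * (q powi k * \<gamma>)) | (s::real) (k::int). s \<in> {1, -1}}"

text \<open>A function on the lattice is represented by a total function on \<open>\<complex>\<close> of which only the
  values on the lattice are relevant: the integral, and hence the moments and function spaces
  below, do not depend on the other values. The integral is generic in the codomain so that it
  serves for the complex-valued \<open>f(x) x\<^sup>e\<close> as well as for the real-valued \<open>\<bar>f(x) x\<^sup>e\<bar>\<close>.\<close>

definition jackson_integrable ::
  "real \<Rightarrow> real \<Rightarrow> (complex \<Rightarrow> 'a::real_normed_vector) \<Rightarrow> bool" where
  "jackson_integrable q \<gamma> f \<longleftrightarrow>
     (\<lambda>(k::int, s::real). norm ((q powi k * \<gamma>) *\<^sub>R f (of_real (s * (q powi k * \<gamma>)))))
       summable_on (UNIV \<times> {1, -1})"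

definition jackson_integral ::
  "real \<Rightarrow> real \<Rightarrow> (complex \<Rightarrow> 'a::real_normed_vector) \<Rightarrow> 'a" where
  "jackson_integral q \<gamma> f = (1 - q) *\<^sub>R
     (\<Sum>\<^sub>\<infinity>(k::int, s::real) \<in> UNIV \<times> {1, -1}.
        (q powi k * \<gamma>) *\<^sub>R f (of_real (s * (q powi k * \<gamma>))))"

definition I_inf :: "real \<Rightarrow> real \<Rightarrow> (complex \<Rightarrow> complex) set" where
  "I_inf q \<gamma> = {f. \<forall>e::nat. jackson_integrable q \<gamma> (\<lambda>x. f x * x ^ e)}"

definition qmoment :: "real \<Rightarrow> real \<Rightarrow> nat \<Rightarrow> (complex \<Rightarrow> complex) \<Rightarrow> complex" where
  "qmoment q \<gamma> e f =
     of_real (q ^ ((e\<^sup>2 + e) div 2)) * jackson_integral q \<gamma> (\<lambda>x. f x * x ^ e)"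

definition abs_qmoment :: "real \<Rightarrow> real \<Rightarrow> nat \<Rightarrow> (complex \<Rightarrow> complex) \<Rightarrow> real" where
  "abs_qmoment q \<gamma> e f =
     q ^ ((e\<^sup>2 + e) div 2) * jackson_integral q \<gamma> (\<lambda>x. norm (f x * x ^ e))"

definition I_omega :: "real \<Rightarrow> real \<Rightarrow> (complex \<Rightarrow> complex) set" where
  "I_omega q \<gamma> = {f \<in> I_inf q \<gamma>. \<exists>\<alpha> b :: real. \<alpha> > 0 \<and> b > 0 \<and>
     (\<lambda>e. norm (qmoment q \<gamma> e f)) \<in> O(\<lambda>e. q powr (\<alpha> * real e ^ 2 / 2) * b ^ e)}"

definition I_s_omega :: "real \<Rightarrow> real \<Rightarrow> (complex \<Rightarrow> complex) set" where
  "I_s_omega q \<gamma> = {f \<in> I_inf q \<gamma>. \<exists>\<alpha> b :: real. \<alpha> > 0 \<and> b > 0 \<and>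
     (\<lambda>e. abs_qmoment q \<gamma> e f) \<in> O(\<lambda>e. q powr (\<alpha> * real e ^ 2 / 2) * b ^ e)}"

definition HD_I_omega :: "real \<Rightarrow> real \<Rightarrow> (complex \<Rightarrow> complex) set" where
  "HD_I_omega q \<gamma> = {f \<in> I_omega q \<gamma>. \<exists>r > 0. \<exists>h. h holomorphic_on ball 0 r \<and>
     (\<forall>x \<in> qlattice q \<gamma> \<inter> ball 0 r. f x = h x)}"

definition HS_I_s_omega_half :: "real \<Rightarrow> real \<Rightarrow> (complex \<Rightarrow> complex) set" where
  "HS_I_s_omega_half q \<gamma> = {f \<in> I_inf q \<gamma>.
     (\<exists>\<alpha> b :: real. 1/2 < \<alpha> \<and> \<alpha> \<le> 1 \<and> b > 0 \<and>
       (\<lambda>e. abs_qmoment q \<gamma> e f) \<in> O(\<lambda>e. q powr (\<alpha> * real e ^ 2 / 2) * b ^ e)) \<and>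
     (\<exists>a > 0. \<exists>h. h holomorphic_on {z. \<bar>Im z\<bar> < a} \<and> (\<forall>x \<in> qlattice q \<gamma>. f x = h x))}"

definition qconv_term ::
  "real \<Rightarrow> real \<Rightarrow> (complex \<Rightarrow> complex) \<Rightarrow> (complex \<Rightarrow> complex) \<Rightarrow> complex \<Rightarrow> nat \<Rightarrow> complex" where
  "qconv_term q \<gamma> f g x e =
     (-1) ^ e * qmoment q \<gamma> e f / of_real (qfact q e) * (qderiv q ^^ e) g x"

text \<open>For \<open>x \<noteq> 0\<close> the iterated \<open>q\<close>-derivatives at \<open>x\<close> only involve the values of \<open>g\<close> at
  \<open>q\<^sup>jx\<close>, so on a lattice where \<open>g\<close> is given they are always defined.\<close>

definition qconv_defined ::
  "real \<Rightarrow> real \<Rightarrow> (complex \<Rightarrow> complex) \<Rightarrow> (complex \<Rightarrow> complex) \<Rightarrow> complex \<Rightarrow> bool" where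
  "qconv_defined q \<gamma> f g x \<longleftrightarrow>
     (x = 0 \<longrightarrow> (\<exists>r > 0. g holomorphic_on ball 0 r)) \<and>
     summable (\<lambda>e. norm (qconv_term q \<gamma> f g x e))"

definition qconv ::
  "real \<Rightarrow> real \<Rightarrow> (complex \<Rightarrow> complex) \<Rightarrow> (complex \<Rightarrow> complex) \<Rightarrow> complex \<Rightarrow> complex" where
  "qconv q \<gamma> f g x = (\<Sum>e. qconv_term q \<gamma> f g x e)"

definition qFourier_integrand ::
  "real \<Rightarrow> (complex \<Rightarrow> complex) \<Rightarrow> complex \<Rightarrow> complex \<Rightarrow> complex" where
  "qFourier_integrand q f y x = qExp q (\<i> * of_real q * x * y) * f x"

definition qFourier :: "real \<Rightarrow> real \<Rightarrow> (complex \<Rightarrow> complex) \<Rightarrow> complex \<Rightarrow> complex" where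
  "qFourier q \<gamma> f y = jackson_integral q \<gamma> (qFourier_integrand q f y)"

definition qFourier_series_term ::
  "real \<Rightarrow> real \<Rightarrow> (complex \<Rightarrow> complex) \<Rightarrow> complex \<Rightarrow> nat \<Rightarrow> complex" where
  "qFourier_series_term q \<gamma> f y k = qmoment q \<gamma> k f * (\<i> * y) ^ k / of_real (qpoch q q k)"

definition qFourier_series :: "real \<Rightarrow> real \<Rightarrow> (complex \<Rightarrow> complex) \<Rightarrow> complex \<Rightarrow> complex" where
  "qFourier_series q \<gamma> f y = (\<Sum>k. qFourier_series_term q \<gamma> f y k)"

end

theory Submission imports Defs begin

text \<open>Everything rests on Fubini for the double sum over the lattice and over \<open>e\<close>, paid for by the
  Gaussian factor \<open>q\<^bsup>\<alpha>e\<^sup>2/2\<^esup>\<close>, which beats every exponential in \<open>e\<close>.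

  Injectivity (d) reduces to determinacy of the moment problem. Vanishing moments can be tested against
  the even entire function \<open>E\<close> of base \<open>q\<^sup>2\<close> whose zeros are the lattice points beyond a given \<open>\<plusminus>R\<close>.
  What remains is a bounded discrete measure with zero moments, whose outermost atoms vanish
  because they dominate the high moments.

  For (e), the \<open>q\<close>-derivative is bounded, with exponentially growing constants in \<open>e\<close>, simultaneously
  for the sup norm of the holomorphic germ at \<open>0\<close> (maximum principle) and for the weighted
  \<open>\<ell>\<^sup>1\<close> norms on the lattice. Integration by parts then yields
  \<open>\<mu>\<^sub>m(f * g) = \<Sum>\<^sub>e [m choose e]\<^sub>q \<mu>\<^sub>e(f) \<mu>\<^bsub>m-e\<^esub>(g)\<close>, a Cauchy product after division by \<open>(q;q)\<^sub>m\<close>.\<close>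

section \<open>Series estimates\<close>

text \<open>Since Gaussian decay absorbs exponentials, all other quantities (q-factorials, norms of
  iterated q-derivatives) are estimated only up to factors of the form B^e. In (d) the lattice is
  unbounded and has no outermost point. Each lattice point is made outermost by a test function of
  its own, so no induction over the lattice takes place. In (e) the obstacle is the division by x in
  the q-derivative: near 0 a weighted l1 norm alone would lose a power of |x| with each derivative.
  The sup norm of the germ repairs this. As z -> qz maps a disc around 0 into itself, the
  q-derivative acts on one fixed disc without loss of radius, and a bound there also bounds the
  lattice sum near 0. The interchange of sums is made for one moment order m at a time. It uses a
  single absolute moment order of g and its derivatives, while the decay comes from the signed
  moments of f. The decay of the moments of g enters only when those of f * g are estimated.\<close>

lemma bigo_imp_bound_all:
  fixes f g :: "nat \<Rightarrow> real"
  assumes "f \<in> O(g)" and pos: "\<And>n. g n > 0"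
  obtains C where "C > 0" "\<And>n. norm (f n) \<le> C * g n"
proof -
  obtain c where c: "c > 0" "eventually (\<lambda>n. norm (f n) \<le> c * norm (g n)) at_top"
    using assms(1) by (elim landau_o.bigE) auto
  then obtain N where N: "\<And>n. n \<ge> N \<Longrightarrow> norm (f n) \<le> c * norm (g n)"
    by (auto simp: eventually_at_top_linorder)
  \<comment> \<open>The sum dominates each of the finitely many ratios not covered by c.\<close>
  define C where "C = c + (\<Sum>n<N. norm (f n) / g n)"
  have nonneg: "norm (f n) / g n \<ge> 0" for n using pos[of n] by simp
  show ?thesis
  proof
    show "C > 0" unfolding C_def using c(1) nonneg by (simp add: add_pos_nonneg sum_nonneg)
    fix n show "norm (f n) \<le> C * g n"
    proof (cases "n < N")
      case True
      then have "norm (f n) / g n \<le> (\<Sum>n<N. norm (f n) / g n)"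
        using nonneg by (intro member_le_sum) auto
      also have "\<dots> \<le> C" using c(1) by (simp add: C_def)
      finally show ?thesis using pos[of n] by (simp add: field_simps)
    next
      case False
      then have "norm (f n) \<le> c * g n" using N[of n] pos[of n] by simp
      also have "\<dots> \<le> C * g n"
        using pos[of n] nonneg by (intro mult_right_mono) (auto simp: C_def sum_nonneg)
      finally show ?thesis .
    qed
  qed
qed

text \<open>Root test: the term is the n-th power of B q^(a n/2), and this base tends to 0.\<close>

lemma summable_gauss:
  fixes q a B :: real
  assumes q: "0 < q" "q < 1" and a: "a > 0" and B: "B > 0"
  shows "summable (\<lambda>n. q powr (a * real n ^ 2 / 2) * B ^ n)"
proof -
  have "((\<lambda>n. B * (q powr (a / 2)) ^ n) \<longlonglongrightarrow> B * 0)"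
    using q a by (intro tendsto_mult tendsto_const LIMSEQ_power_zero) (simp add: powr01_less_one)
  then have "eventually (\<lambda>n. B * (q powr (a / 2)) ^ n < 1/2) sequentially"
    by (rule order_tendstoD) simp
  then obtain N where N: "\<And>n. n \<ge> N \<Longrightarrow> B * (q powr (a / 2)) ^ n < 1/2"
    by (auto simp: eventually_at_top_linorder)
  show ?thesis
  proof (rule summable_comparison_test')
    show "summable (\<lambda>n. (1/2 :: real) ^ n)" by (simp add: summable_geometric)
    fix n assume n: "n \<ge> N"
    have "q powr (a * real n ^ 2 / 2) = ((q powr (a/2)) ^ n) ^ n"
      using q by (simp add: powr_powr flip: powr_realpow) (simp add: power2_eq_square mult_ac)
    then have "q powr (a * real n ^ 2 / 2) * B ^ n = (B * (q powr (a / 2)) ^ n) ^ n"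
      by (simp add: power_mult_distrib)
    also have "\<dots> \<le> (1/2) ^ n" using N[OF n] B by (intro power_mono) auto
    finally show "norm (q powr (a * real n ^ 2 / 2) * B ^ n) \<le> (1/2) ^ n"
      using B by simp
  qed
qed

lemma summable_gauss_bounded:
  fixes c :: "nat \<Rightarrow> 'a::real_normed_vector" and q a b B C :: real
  assumes q: "0 < q" "q < 1" and a: "a > 0" and b: "b > 0" and B: "B \<ge> 0"
    and c: "\<And>n. norm (c n) \<le> C * (q powr (a * real n ^ 2 / 2) * b ^ n)"
  shows "summable (\<lambda>n. norm (c n) * B ^ n)"
proof (rule summable_comparison_test')
  \<comment> \<open>\<open>B + 1\<close> instead of \<open>B\<close> keeps the geometric base
    positive when B = 0.\<close>
  show "summable (\<lambda>n. C * (q powr (a * real n ^ 2 / 2) * (b * (B + 1)) ^ n))"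
    using assms by (intro summable_mult summable_gauss) auto
  fix n :: nat assume "n \<ge> 0"
  have "norm (c n) * B ^ n \<le> C * (q powr (a * real n ^ 2 / 2) * b ^ n) * (B + 1) ^ n"
    using c[of n] order_trans[OF norm_ge_zero c[of n]] B by (intro mult_mono power_mono) auto
  also have "\<dots> = C * (q powr (a * real n ^ 2 / 2) * (b * (B + 1)) ^ n)"
    by (simp add: power_mult_distrib mult_ac)
  finally show "norm (norm (c n) * B ^ n) \<le> C * (q powr (a * real n ^ 2 / 2) * (b * (B + 1)) ^ n)"
    using B by simp
qed

lemma infsum_nat_eq_suminf:
  fixes f :: "nat \<Rightarrow> 'a::banach"
  assumes "summable (\<lambda>n. norm (f n))"
  shows "infsum f UNIV = suminf f"
  using assms norm_summable_imp_has_sum[OF assms] summable_norm_cancel[OF assms]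
  by (intro infsumI) (auto simp: summable_sums)

text \<open>Fubini in mixed form: the power series index is summed by \<open>suminf\<close>, the
  lattice index by \<open>infsum\<close>. Summability of the iterated sum of norms gives absolute
  summability on the product, from which all three conclusions are read off.\<close>

lemma series_infsum_interchange:
  fixes F :: "nat \<Rightarrow> 'i \<Rightarrow> 'a::banach"
  assumes inner: "\<And>e. (\<lambda>i. norm (F e i)) summable_on A"
    and outer: "summable (\<lambda>e. infsum (\<lambda>i. norm (F e i)) A)"
  shows series_infsum_summable: "\<And>i. i \<in> A \<Longrightarrow> summable (\<lambda>e. norm (F e i))"
    and series_infsum_abs_summable: "(\<lambda>i. norm (suminf (\<lambda>e. F e i))) summable_on A"
    and series_infsum_swap: "(\<lambda>e. infsum (F e) A) sums (infsum (\<lambda>i. suminf (\<lambda>e. F e i)) A)"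
proof -
  define G where "G = (\<lambda>(e, i). F e i)"
  have nn: "infsum (\<lambda>i. norm (F e i)) A \<ge> 0" for e by (simp add: infsum_nonneg)
  have G: "(\<lambda>x. norm (G x)) summable_on (UNIV \<times> A)"
    unfolding Infinite_Sum.abs_summable_on_Sigma_iff
  proof (intro conjI ballI)
    show "(\<lambda>e. norm (infsum (\<lambda>i. norm (G (e, i))) A)) summable_on UNIV"
      using outer nn by (simp add: G_def summable_on_UNIV_nonneg_real_iff)
  qed (use inner in \<open>simp add: G_def\<close>)
  \<comment> \<open>With the factors exchanged, the same product criterion yields convergence in e
    for every single i, not only for the iterated sum.\<close>
  define H where "H = (\<lambda>(i, e). F e i)"
  have "(\<lambda>x. norm (H x)) summable_on (A \<times> UNIV)"
  proof -
    have "(\<lambda>x. norm (H (prod.swap x))) summable_on (UNIV \<times> A)"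
      using G by (simp add: H_def G_def case_prod_unfold)
    moreover have "bij_betw prod.swap (UNIV \<times> A) (A \<times> (UNIV :: nat set))"
      by (rule bij_betwI[of _ _ _ prod.swap]) auto
    ultimately show ?thesis
      using summable_on_reindex_bij_betw[of prod.swap "UNIV \<times> A" "A \<times> UNIV" "\<lambda>x. norm (H x)"] by simp
  qed
  then have H: "\<And>i. i \<in> A \<Longrightarrow> (\<lambda>e. norm (F e i)) summable_on UNIV"
    "(\<lambda>i. infsum (\<lambda>e. norm (F e i)) UNIV) summable_on A"
    unfolding Infinite_Sum.abs_summable_on_Sigma_iff H_def using summable_on_iff_abs_summable_on_real by auto
  show sm: "summable (\<lambda>e. norm (F e i))" if "i \<in> A" for i
    using H(1)[OF that] by (simp add: summable_on_UNIV_nonneg_real_iff)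
  show "(\<lambda>i. norm (suminf (\<lambda>e. F e i))) summable_on A"
  proof (rule Infinite_Sum.abs_summable_on_comparison_test'[OF H(2)])
    fix i assume i: "i \<in> A"
    have "norm (suminf (\<lambda>e. F e i)) \<le> suminf (\<lambda>e. norm (F e i))"
      by (rule summable_norm[OF sm[OF i]])
    also have "\<dots> = infsum (\<lambda>e. norm (F e i)) UNIV"
      using sm[OF i] by (subst infsum_nat_eq_suminf) auto
    finally show "norm (suminf (\<lambda>e. F e i)) \<le> infsum (\<lambda>e. norm (F e i)) UNIV" .
  qed
  have GS: "G summable_on (UNIV \<times> A)" using G by (rule abs_summable_summable)
  have "infsum (\<lambda>e. infsum (F e) A) UNIV = infsum (\<lambda>i. infsum (\<lambda>e. F e i) UNIV) A"
    using GS unfolding G_def by (rule infsum_swap_banach)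
  also have "\<dots> = infsum (\<lambda>i. suminf (\<lambda>e. F e i)) A"
    by (intro infsum_cong infsum_nat_eq_suminf sm)
  finally have eq: "infsum (\<lambda>e. infsum (F e) A) UNIV = infsum (\<lambda>i. suminf (\<lambda>e. F e i)) A" .
  have "summable (\<lambda>e. norm (infsum (F e) A))"
    using outer by (rule summable_comparison_test') (auto intro!: norm_infsum_bound inner)
  with eq show "(\<lambda>e. infsum (F e) A) sums (infsum (\<lambda>i. suminf (\<lambda>e. F e i)) A)"
    using infsum_nat_eq_suminf[of "\<lambda>e. infsum (F e) A"]
      summable_sums[OF summable_norm_cancel[of "\<lambda>e. infsum (F e) A"]] by simp
qed

text \<open>A nonzero coefficient of positive index would make the zero at 0 isolated. The constant
  coefficient is outside that argument and is read off at y = 0.\<close>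

lemma powser_all_zero:
  fixes a :: "nat \<Rightarrow> complex"
  assumes "\<And>y. (\<lambda>n. a n * y ^ n) sums 0"
  shows "a n = 0"
proof (rule ccontr)
  assume an: "a n \<noteq> 0"
  show False
  proof (cases "\<exists>m>0. a m \<noteq> 0")
    case True
    then obtain m where m: "m > 0" "a m \<noteq> 0" by blast
    show False
    proof (rule powser_0_nonzero[of 1 0 a "\<lambda>_. 0" m])
      fix s :: real assume s: "0 < s" "\<And>z::complex. z \<in> cball 0 s - {0} \<Longrightarrow> (0::complex) \<noteq> 0"
      have "complex_of_real s \<in> cball 0 s - {0}" using s(1) by auto
      from s(2)[OF this] show False by simp
    qed (use assms m in simp_all)
  next
    case False
    then have "n = 0" using an by (cases n) auto
    have "a 0 = 0" using assms[of 0] powser_sums_zero_iff by blast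
    then show False using an \<open>n = 0\<close> by simp
  qed
qed

section \<open>Elementary bounds on (q;q)_k\<close>

context
  fixes q :: real
  assumes q: "0 < q" "q < 1"
begin

lemma qpoch_Suc: "qpoch q q (Suc k) = qpoch q q k * (1 - q ^ Suc k)"
  by (simp add: qpoch_def)

lemma qpoch_pos: "qpoch q q k > 0"
  unfolding qpoch_def
  using q by (intro prod_pos) (auto simp flip: power_Suc intro!: power_Suc_less_one)

text \<open>Very crude, as (q;q)_k has a positive limit, but an exponential bound is all that the
  Gaussian estimates ask for.\<close>

lemma qpoch_ge: "qpoch q q k \<ge> (1 - q) ^ k"
proof -
  have "(\<Prod>j<k. 1 - q) \<le> qpoch q q k"
    unfolding qpoch_def using q by (intro prod_mono) (auto simp: mult_left_le power_le_one)
  then show ?thesis by simp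
qed

lemma qpoch_le_1: "qpoch q q k \<le> 1"
  unfolding qpoch_def using q
  by (intro prod_le_1) (auto simp flip: power_Suc simp: power_le_one)

lemma inverse_qpoch_le: "1 / qpoch q q k \<le> (1 / (1 - q)) ^ k"
  using qpoch_ge[of k] qpoch_pos[of k] q by (simp add: power_one_over field_simps)

end

section \<open>Moments on the lattice and the Fourier series\<close>

lemma real_triangle_plus: "real ((e\<^sup>2 + e) div 2) = (real e ^ 2 + real e) / 2"
proof -
  have "2 dvd (e\<^sup>2 + e)" by (cases "even e") auto
  then show ?thesis by (simp add: real_of_nat_div)
qed

lemma real_triangle_minus: "real (k * (k - 1) div 2) = (real k ^ 2 - real k) / 2"
proof -
  have "2 dvd (k * (k - 1))" by (cases "even k") auto
  then show ?thesis
    by (cases k) (simp_all add: real_of_nat_div power2_eq_square algebra_simps)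
qed

text \<open>The extra q in the kernel E_q(iqxy) contributes q^k. This identity turns the coefficient
  exponent of E_q into the normalising exponent of the moments.\<close>

lemma triangle_shift: "k * (k - 1) div 2 + k = (k\<^sup>2 + k) div (2::nat)"
proof -
  have "real (k * (k - 1) div 2 + k) = real ((k\<^sup>2 + k) div 2)"
    unfolding of_nat_add real_triangle_plus real_triangle_minus by (simp add: field_simps)
  then show ?thesis by linarith
qed

lemma qExp_summable:
  fixes q :: real and x :: complex
  assumes q: "0 < q" "q < 1"
  shows "summable (\<lambda>k. norm (of_real (q ^ (k * (k - 1) div 2)) * x ^ k / of_real (qpoch q q k)))"
proof (rule summable_comparison_test')
  show "summable (\<lambda>k. norm (q ^ (k * (k - 1) div 2)) * (norm x * (1 / (1 - q))) ^ k)"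
  \<comment> \<open>The factor q^(n(n-1)/2) is Gaussian with \<alpha> = 1 and b = q^(-1/2).\<close>
  proof (rule summable_gauss_bounded[OF q, of 1 "q powr (-1/2)"])
    fix n :: nat
    have "q ^ (n * (n - 1) div 2) = q powr ((real n ^ 2 - real n) / 2)"
      using q by (simp only: powr_realpow[OF q(1), symmetric] real_triangle_minus)
    also have "\<dots> = q powr (real n ^ 2 / 2) * (q powr (-1/2)) ^ n"
      using q by (simp add: powr_powr diff_divide_distrib flip: powr_realpow powr_add)
    finally show "norm (q ^ (n * (n - 1) div 2)) \<le> 1 * (q powr (1 * (real n)\<^sup>2 / 2) * (q powr (-1/2)) ^ n)"
      using q by simp
  qed (use q in auto)
  fix n :: nat assume "n \<ge> 0"
  show "norm (norm (of_real (q ^ (n * (n - 1) div 2)) * x ^ n / of_real (qpoch q q n)))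
     \<le> norm (q ^ (n * (n - 1) div 2)) * (norm x * (1 / (1 - q))) ^ n"
    using inverse_qpoch_le[OF q, of n] qpoch_pos[OF q, of n] q
    by (simp add: norm_mult norm_divide norm_power power_mult_distrib norm_inverse divide_inverse mult.assoc
        mult_left_mono)
qed

locale jackson_lattice =
  fixes q \<gamma> :: real
  assumes q_pos: "0 < q" and q_lt_1: "q < 1" and \<gamma>_pos: "0 < \<gamma>"
begin

text \<open>Exponent and sign, as in the Jackson sum itself; multiplication of x by q becomes a
  shift of the first component.\<close>

definition Lat :: "(int \<times> real) set" where "Lat = UNIV \<times> {1, -1}"
definition wt :: "int \<times> real \<Rightarrow> real" where "wt p = q powi fst p * \<gamma>"
definition pt :: "int \<times> real \<Rightarrow> complex" where "pt p = of_real (snd p * wt p)"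

text \<open>\<open>\<nu>\<^sub>m\<close> without the factors \<open>1 - q\<close> and \<open>q\<^bsup>(m\<^sup>2+m)/2\<^esup>\<close>; the lattice points satisfy
  \<open>\<bar>x\<bar> = wt\<close>, hence the exponent \<open>m + 1\<close>.\<close>

definition amom :: "nat \<Rightarrow> (complex \<Rightarrow> complex) \<Rightarrow> real" where
  "amom m u = infsum (\<lambda>p. wt p ^ Suc m * norm (u (pt p))) Lat"

lemma wt_pos [simp]: "wt p > 0"
  using q_pos \<gamma>_pos by (simp add: wt_def)

lemma wt_nonneg [simp]: "wt p \<ge> 0" and abs_wt [simp]: "\<bar>wt p\<bar> = wt p" and wt_neq_0 [simp]: "wt p \<noteq> 0"
  using wt_pos[of p] by linarith+

lemma norm_pt: "p \<in> Lat \<Longrightarrow> norm (pt p) = wt p"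
  by (auto simp: pt_def Lat_def norm_mult)

lemma pt_neq_0: "p \<in> Lat \<Longrightarrow> pt p \<noteq> 0"
  using norm_pt[of p] wt_pos[of p] by force

lemma qlattice_eq: "qlattice q \<gamma> = pt ` Lat"
  unfolding qlattice_def pt_def wt_def Lat_def by (auto simp: image_iff)

lemma jackson_integrable_iff:
  "jackson_integrable q \<gamma> f \<longleftrightarrow> (\<lambda>p. wt p * norm (f (pt p))) summable_on Lat"
proof -
  have "(\<lambda>(k::int, s::real). norm ((q powi k * \<gamma>) *\<^sub>R f (of_real (s * (q powi k * \<gamma>)))))
     = (\<lambda>p. \<bar>wt p\<bar> * norm (f (pt p)))"
    by (auto simp: wt_def pt_def fun_eq_iff simp del: abs_wt)
  then show ?thesis by (simp add: jackson_integrable_def Lat_def)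
qed

lemma jackson_integral_eq:
  "jackson_integral q \<gamma> f = (1 - q) *\<^sub>R infsum (\<lambda>p. wt p *\<^sub>R f (pt p)) Lat"
proof -
  have "(\<lambda>(k::int, s::real). (q powi k * \<gamma>) *\<^sub>R f (of_real (s * (q powi k * \<gamma>))))
     = (\<lambda>p. wt p *\<^sub>R f (pt p))"
    by (auto simp: wt_def pt_def fun_eq_iff)
  then show ?thesis by (simp add: jackson_integral_def Lat_def)
qed

lemma wt_norm_moment:
  "p \<in> Lat \<Longrightarrow> wt p * norm (f (pt p) * pt p ^ e) = wt p ^ Suc e * norm (f (pt p))"
  by (simp add: norm_mult norm_power norm_pt)

lemma I_inf_iff:
  "f \<in> I_inf q \<gamma> \<longleftrightarrow> (\<forall>e. (\<lambda>p. wt p ^ Suc e * norm (f (pt p))) summable_on Lat)"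
  unfolding I_inf_def jackson_integrable_iff mem_Collect_eq
  by (intro iff_allI summable_on_cong wt_norm_moment)

lemma I_infD: "f \<in> I_inf q \<gamma> \<Longrightarrow> (\<lambda>p. wt p ^ Suc e * norm (f (pt p))) summable_on Lat"
  by (simp only: I_inf_iff)

lemma amom_nonneg: "amom m u \<ge> 0"
  unfolding amom_def by (intro infsum_nonneg) auto

lemma abs_qmoment_eq: "abs_qmoment q \<gamma> e f = q ^ ((e\<^sup>2 + e) div 2) * ((1 - q) * amom e f)"
proof -
  have "infsum (\<lambda>p. wt p * norm (f (pt p) * pt p ^ e)) Lat = amom e f"
    unfolding amom_def by (intro infsum_cong wt_norm_moment)
  then show ?thesis by (simp add: abs_qmoment_def jackson_integral_eq)
qed

lemma abs_qmoment_nonneg: "abs_qmoment q \<gamma> e f \<ge> 0"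
  using q_pos q_lt_1 amom_nonneg[of e f] by (simp add: abs_qmoment_eq)

lemma norm_qmoment_le:
  assumes "f \<in> I_inf q \<gamma>"
  shows "norm (qmoment q \<gamma> e f) \<le> abs_qmoment q \<gamma> e f"
proof -
  have eq: "norm (wt p *\<^sub>R (f (pt p) * pt p ^ e)) = wt p ^ Suc e * norm (f (pt p))" if "p \<in> Lat" for p
    using wt_norm_moment[OF that] by simp
  have "norm (infsum (\<lambda>p. wt p *\<^sub>R (f (pt p) * pt p ^ e)) Lat)
      \<le> infsum (\<lambda>p. norm (wt p *\<^sub>R (f (pt p) * pt p ^ e))) Lat"
    using I_infD[OF assms, of e]
    by (intro norm_infsum_bound) (simp only: eq cong: summable_on_cong)
  also have "\<dots> = amom e f"
    unfolding amom_def by (intro infsum_cong eq)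
  finally show ?thesis
    using q_pos q_lt_1
    by (simp add: qmoment_def jackson_integral_eq abs_qmoment_eq norm_mult norm_power mult_left_mono)
qed

lemma gauss_weight_pos: "b > 0 \<Longrightarrow> q powr (a * real e ^ 2 / 2) * b ^ e > 0"
  using q_pos by simp

lemma I_omega_bound:
  assumes "f \<in> I_omega q \<gamma>"
  obtains \<alpha> b C where "\<alpha> > 0" "b > 0" "C > 0"
    "\<And>e. norm (qmoment q \<gamma> e f) \<le> C * (q powr (\<alpha> * real e ^ 2 / 2) * b ^ e)"
proof -
  obtain \<alpha> b where ab: "\<alpha> > 0" "b > 0"
    and O: "(\<lambda>e. norm (qmoment q \<gamma> e f)) \<in> O(\<lambda>e. q powr (\<alpha> * real e ^ 2 / 2) * b ^ e)"
    using assms unfolding I_omega_def by blast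
  from bigo_imp_bound_all[OF O gauss_weight_pos[OF ab(2)]] obtain C where "C > 0"
    "\<And>e. norm (norm (qmoment q \<gamma> e f)) \<le> C * (q powr (\<alpha> * real e ^ 2 / 2) * b ^ e)" by blast
  then show ?thesis using that[OF ab] by simp
qed

section \<open>The moment series and its comparison with the Fourier integral\<close>

lemma summable_moments:
  assumes "f \<in> I_omega q \<gamma>" "B \<ge> 0"
  shows "summable (\<lambda>e. norm (qmoment q \<gamma> e f) * B ^ e)"
  by (rule I_omega_bound[OF assms(1)]) (rule summable_gauss_bounded[OF q_pos q_lt_1 _ _ assms(2)])

lemma summable_norm_qFourier_series_term:
  assumes "f \<in> I_omega q \<gamma>"
  shows "summable (\<lambda>k. norm (qFourier_series_term q \<gamma> f y k))"
proof (rule summable_comparison_test')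
  show "summable (\<lambda>e. norm (qmoment q \<gamma> e f) * (norm y * (1 / (1 - q))) ^ e)"
    using q_lt_1 by (intro summable_moments assms) auto
  fix n :: nat assume "n \<ge> 0"
  have "norm y ^ n * (1 / qpoch q q n) \<le> norm y ^ n * (1 / (1 - q)) ^ n"
    by (intro mult_left_mono inverse_qpoch_le q_pos q_lt_1) auto
  then have "norm (qmoment q \<gamma> n f) * (norm y ^ n * (1 / qpoch q q n))
      \<le> norm (qmoment q \<gamma> n f) * (norm y ^ n * (1 / (1 - q)) ^ n)"
    by (rule mult_left_mono) simp
  then show "norm (norm (qFourier_series_term q \<gamma> f y n))
      \<le> norm (qmoment q \<gamma> n f) * (norm y * (1 / (1 - q))) ^ n"
    using qpoch_pos[OF q_pos q_lt_1, of n]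
    unfolding qFourier_series_term_def power_mult_distrib
    by (simp add: norm_mult norm_divide norm_power)
qed

lemmas summable_qFourier_series_term = summable_norm_cancel[OF summable_norm_qFourier_series_term]

lemma qFourier_series_sums:
  assumes "f \<in> I_omega q \<gamma>"
  shows "(\<lambda>k. (qmoment q \<gamma> k f * \<i> ^ k / of_real (qpoch q q k)) * y ^ k) sums qFourier_series q \<gamma> f y"
  using summable_sums[OF summable_qFourier_series_term[OF assms, of y]]
  by (simp add: qFourier_series_def qFourier_series_term_def power_mult_distrib mult_ac)

lemma holomorphic_qFourier_series:
  assumes "f \<in> I_omega q \<gamma>"
  shows "qFourier_series q \<gamma> f holomorphic_on UNIV"
proof -
  have "qFourier_series q \<gamma> f holomorphic_on ball 0 (norm z + 1)" for z
    by (rule power_series_holomorphic[where a = "\<lambda>k. qmoment q \<gamma> k f * \<i> ^ k / of_real (qpoch q q k)"])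
      (use qFourier_series_sums[OF assms] in simp)
  then have "qFourier_series q \<gamma> f field_differentiable at z" for z
    by (rule holomorphic_on_imp_differentiable_at[of _ "ball 0 (norm z + 1)"]) auto
  then show ?thesis
    by (auto simp: holomorphic_on_def intro: field_differentiable_at_within)
qed

lemma qFourier_series_eq_0_iff:
  assumes "f \<in> I_omega q \<gamma>"
  shows "(\<forall>y. qFourier_series q \<gamma> f y = 0) \<longleftrightarrow> (\<forall>k. qmoment q \<gamma> k f = 0)"
proof
  assume "\<forall>y. qFourier_series q \<gamma> f y = 0"
  then have "qmoment q \<gamma> k f * \<i> ^ k / of_real (qpoch q q k) = 0" for k
    using qFourier_series_sums[OF assms] by (intro powser_all_zero) simp
  moreover have "qpoch q q k \<noteq> 0" for k using qpoch_pos[OF q_pos q_lt_1, of k] by simp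
  ultimately show "\<forall>k. qmoment q \<gamma> k f = 0" by simp
qed (simp add: qFourier_series_def qFourier_series_term_def)

lemma abs_moment_bound:
  assumes "(\<lambda>e. abs_qmoment q \<gamma> e f) \<in> O(\<lambda>e. q powr (\<alpha> * real e ^ 2 / 2) * b ^ e)" "b > 0"
  obtains C where "C > 0" "\<And>e. abs_qmoment q \<gamma> e f \<le> C * (q powr (\<alpha> * real e ^ 2 / 2) * b ^ e)"
  using bigo_imp_bound_all[OF assms(1) gauss_weight_pos[OF assms(2)]] abs_qmoment_nonneg
  by (metis abs_of_nonneg real_norm_def)

lemma summable_abs_moments:
  assumes "f \<in> I_s_omega q \<gamma>" "B \<ge> 0"
  shows "summable (\<lambda>e. abs_qmoment q \<gamma> e f * B ^ e)"
proof -
  obtain \<alpha> b where ab: "\<alpha> > 0" "b > 0"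
    and O: "(\<lambda>e. abs_qmoment q \<gamma> e f) \<in> O(\<lambda>e. q powr (\<alpha> * real e ^ 2 / 2) * b ^ e)"
    using assms unfolding I_s_omega_def by blast
  obtain C where "\<And>e. abs_qmoment q \<gamma> e f \<le> C * (q powr (\<alpha> * real e ^ 2 / 2) * b ^ e)"
    using abs_moment_bound[OF O ab(2)] by blast
  then have "summable (\<lambda>e. norm (abs_qmoment q \<gamma> e f) * B ^ e)"
    by (intro summable_gauss_bounded[OF q_pos q_lt_1 ab assms(2), of _ C])
      (simp add: abs_qmoment_nonneg)
  then show ?thesis by (simp add: abs_qmoment_nonneg)
qed

lemma I_s_omega_subset: "I_s_omega q \<gamma> \<subseteq> I_omega q \<gamma>"
proof
  fix f assume f: "f \<in> I_s_omega q \<gamma>"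
  then obtain \<alpha> b where ab: "\<alpha> > 0" "b > 0" and inf: "f \<in> I_inf q \<gamma>"
    and O: "(\<lambda>e. abs_qmoment q \<gamma> e f) \<in> O(\<lambda>e. q powr (\<alpha> * real e ^ 2 / 2) * b ^ e)"
    unfolding I_s_omega_def by blast
  have "(\<lambda>e. norm (qmoment q \<gamma> e f)) \<in> O(\<lambda>e. abs_qmoment q \<gamma> e f)"
    using norm_qmoment_le[OF inf] abs_qmoment_nonneg
    by (intro landau_o.bigI[of 1]) auto
  from landau_o.big_trans[OF this O] show "f \<in> I_omega q \<gamma>"
    using ab inf unfolding I_omega_def by blast
qed

text \<open>E_q is expanded under the integral sign. Termwise this produces exactly the moment
  series, and the exchange is licensed by the decay of the absolute moments, which dominate the
  double series of norms.\<close>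

lemma qFourier_eq_series:
  assumes f: "f \<in> I_s_omega q \<gamma>"
  shows "jackson_integrable q \<gamma> (qFourier_integrand q f y)"
    and "qFourier q \<gamma> f y = qFourier_series q \<gamma> f y"
proof -
  have inf: "f \<in> I_inf q \<gamma>" using f by (simp add: I_s_omega_def)
  define c where "c = (\<lambda>k. q ^ ((k\<^sup>2 + k) div 2) / qpoch q q k)"
  have c_nonneg: "c k \<ge> 0" for k
    using qpoch_pos[OF q_pos q_lt_1, of k] q_pos by (simp add: c_def)
  define F where "F = (\<lambda>k p. of_real (c k) * (\<i> * y) ^ k * (wt p *\<^sub>R (f (pt p) * pt p ^ k)))"
  have normF: "norm (F k p) = c k * norm y ^ k * (wt p ^ Suc k * norm (f (pt p)))" if "p \<in> Lat" for k p
    using wt_norm_moment[OF that, of f k] c_nonneg[of k]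
    by (simp add: F_def norm_mult norm_power)
  have 1: "(\<lambda>p. norm (F k p)) summable_on Lat" for k
    using summable_on_cmult_right[OF I_infD[OF inf, of k], of "c k * norm y ^ k"]
    by (simp only: normF cong: summable_on_cong)
  have int: "infsum (\<lambda>p. norm (F k p)) Lat = c k * norm y ^ k * amom k f" for k
    unfolding amom_def by (simp only: normF infsum_cmult_right' cong: infsum_cong)
  have 2: "summable (\<lambda>k. infsum (\<lambda>p. norm (F k p)) Lat)"
  proof (rule summable_comparison_test')
    show "summable (\<lambda>e. 1 / (1 - q) * (abs_qmoment q \<gamma> e f * (norm y * (1 / (1 - q))) ^ e))"
      using q_lt_1 by (intro summable_mult summable_abs_moments f) auto
    fix n :: nat assume "n \<ge> 0"
    have "norm (infsum (\<lambda>p. norm (F n p)) Lat) = c n * norm y ^ n * amom n f"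
      unfolding int using c_nonneg[of n] amom_nonneg[of n f] by simp
    also have "\<dots> = 1 / (1 - q) * (abs_qmoment q \<gamma> n f * (norm y ^ n * (1 / qpoch q q n)))"
      using q_lt_1 by (simp add: c_def abs_qmoment_eq)
    also have "\<dots> \<le> 1 / (1 - q) * (abs_qmoment q \<gamma> n f * (norm y ^ n * (1 / (1 - q)) ^ n))"
      using q_lt_1 by (intro mult_left_mono inverse_qpoch_le q_pos abs_qmoment_nonneg) auto
    finally show "norm (infsum (\<lambda>p. norm (F n p)) Lat)
        \<le> 1 / (1 - q) * (abs_qmoment q \<gamma> n f * (norm y * (1 / (1 - q))) ^ n)"
      by (simp only: power_mult_distrib)
  qed
  have sumF: "suminf (\<lambda>k. F k p) = wt p *\<^sub>R qFourier_integrand q f y (pt p)" for p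
  proof -
    have "F k p = (of_real (wt p) * f (pt p)) * (of_real (q ^ (k * (k - 1) div 2)) *
        (\<i> * of_real q * pt p * y) ^ k / of_real (qpoch q q k))" for k
      unfolding F_def c_def triangle_shift[symmetric] power_add
      by (simp add: power_mult_distrib scaleR_conv_of_real mult_ac)
    then show ?thesis
      using suminf_mult[OF summable_norm_cancel[OF qExp_summable[OF q_pos q_lt_1]],
          of "of_real (wt p) * f (pt p)" "\<i> * of_real q * pt p * y"]
      by (simp add: qFourier_integrand_def qExp_def scaleR_conv_of_real mult_ac)
  qed
  show "jackson_integrable q \<gamma> (qFourier_integrand q f y)"
    using series_infsum_abs_summable[of F Lat, OF 1 2] unfolding sumF jackson_integrable_iff by simp
  have "(\<lambda>k. infsum (F k) Lat) sums infsum (\<lambda>p. wt p *\<^sub>R qFourier_integrand q f y (pt p)) Lat"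
    using series_infsum_swap[of F Lat, OF 1 2] unfolding sumF .
  from sums_scaleR_right[OF this, of "1 - q"]
  have "(\<lambda>k. (1 - q) *\<^sub>R infsum (F k) Lat) sums qFourier q \<gamma> f y"
    by (simp add: qFourier_def jackson_integral_eq)
  moreover have "(1 - q) *\<^sub>R infsum (F k) Lat = qFourier_series_term q \<gamma> f y k" for k
    unfolding F_def infsum_cmult_right'
    by (simp add: c_def qFourier_series_term_def qmoment_def jackson_integral_eq scaleR_conv_of_real mult_ac)
  ultimately show "qFourier q \<gamma> f y = qFourier_series q \<gamma> f y"
    by (simp add: qFourier_series_def sums_unique)
qed

end

section \<open>Injectivity of the Fourier transform\<close>

context
  fixes Q :: real
  assumes Q: "0 < Q" "Q < 1"
begin

lemma qExp_sums:
  "(\<lambda>k. of_real (Q ^ (k * (k - 1) div 2)) * x ^ k / of_real (qpoch Q Q k)) sums qExp Q x"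
  unfolding qExp_def by (intro summable_sums summable_norm_cancel[OF qExp_summable[OF Q]])

text \<open>Comparison of coefficients, by the recursion \<open>c_Suc\<close>. This equation stands
  in for the infinite product: iterating it locates the zeros and shows that -Q is not one.\<close>

lemma qExp_functional_eq: "qExp Q x = (1 + x) * qExp Q (of_real Q * x)"
proof -
  define c where "c = (\<lambda>k. complex_of_real (Q ^ (k * (k - 1) div 2) / qpoch Q Q k))"
  have c_Suc: "c (Suc k) * (1 - of_real Q ^ Suc k) = c k * of_real Q ^ k" for k
  proof -
    have "Suc k * (Suc k - 1) div 2 = k * (k - 1) div 2 + k"
      using triangle_shift[of k] by (simp add: power2_eq_square add.commute)
    moreover have "qpoch Q Q (Suc k) \<noteq> 0" "qpoch Q Q k \<noteq> 0" using qpoch_pos[OF Q, of "Suc k"] qpoch_pos[OF Q, of k] by simp_all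
    moreover from this have "1 - Q ^ Suc k \<noteq> 0" unfolding qpoch_Suc[OF Q] by simp
    ultimately have "(Q ^ (Suc k * (Suc k - 1) div 2) / qpoch Q Q (Suc k)) * (1 - Q ^ Suc k)
        = Q ^ (k * (k - 1) div 2) / qpoch Q Q k * Q ^ k"
      unfolding qpoch_Suc[OF Q] by (simp add: power_add)
    from arg_cong[OF this, of complex_of_real] show ?thesis by (simp add: c_def)
  qed
  have S: "(\<lambda>k. c k * x ^ k) sums qExp Q x" for x
    using qExp_sums[of x] by (simp add: c_def)
  have "(\<lambda>k. c k * x ^ k - c k * (of_real Q * x) ^ k) sums (qExp Q x - qExp Q (of_real Q * x))"
    by (intro sums_diff S)
  then have "(\<lambda>k. c (Suc k) * x ^ Suc k - c (Suc k) * (of_real Q * x) ^ Suc k)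
      sums (qExp Q x - qExp Q (of_real Q * x))"
    by (subst sums_Suc_iff) simp
  moreover have "c (Suc k) * x ^ Suc k - c (Suc k) * (of_real Q * x) ^ Suc k
      = x * (c k * (of_real Q * x) ^ k)" for k
  proof -
    have "c (Suc k) * x ^ Suc k - c (Suc k) * (of_real Q * x) ^ Suc k
        = (c (Suc k) * (1 - of_real Q ^ Suc k)) * x ^ Suc k"
      by (simp only: power_mult_distrib) (simp add: algebra_simps)
    then show ?thesis unfolding c_Suc by (simp add: power_mult_distrib mult_ac)
  qed
  ultimately have "(\<lambda>k. x * (c k * (of_real Q * x) ^ k)) sums (qExp Q x - qExp Q (of_real Q * x))"
    by simp
  moreover have "(\<lambda>k. x * (c k * (of_real Q * x) ^ k)) sums (x * qExp Q (of_real Q * x))"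
    by (intro sums_mult S)
  ultimately have "qExp Q x - qExp Q (of_real Q * x) = x * qExp Q (of_real Q * x)"
    by (rule sums_unique2)
  then show ?thesis by (simp add: algebra_simps)
qed

lemma qExp_eq_0: "qExp Q (- of_real (1 / Q ^ m)) = 0"
proof (induction m)
  case 0
  show ?case by (subst qExp_functional_eq) simp
next
  case (Suc m)
  have "of_real Q * - complex_of_real (1 / Q ^ Suc m) = - of_real (1 / Q ^ m)"
    using Q by simp
  with Suc show ?case by (subst qExp_functional_eq) simp
qed

lemma qExp_0: "qExp Q 0 = 1"
  using powser_zero[of "\<lambda>k. of_real (Q ^ (k * (k - 1) div 2)) / of_real (qpoch Q Q k) :: complex"]
  by (simp add: qExp_def qpoch_def)

lemma isCont_qExp: "isCont (qExp Q) x"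
proof -
  have "isCont (\<lambda>x. \<Sum>k. of_real (Q ^ (k * (k - 1) div 2)) / of_real (qpoch Q Q k) * x ^ k) x"
    by (rule isCont_powser_converges_everywhere) (use sums_summable[OF qExp_sums] in simp)
  then show ?thesis by (simp add: qExp_def[abs_def])
qed

text \<open>A zero at -Q would propagate to every -Q^(n+1), because the factors 1 - Q^(n+1) do not
  vanish. These points tend to 0, where E_Q is continuous with value 1.\<close>

lemma qExp_neq_0: "qExp Q (- of_real Q) \<noteq> 0"
proof
  assume 0: "qExp Q (- of_real Q) = 0"
  have "qExp Q (- of_real (Q ^ Suc n)) = 0" for n
  proof (induction n)
    case (Suc n)
    have "Q ^ Suc n < 1" using Q by (intro power_Suc_less_one) auto
    then have "1 + - complex_of_real (Q ^ Suc n) \<noteq> 0"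
      by (metis eq_iff_diff_eq_0 less_irrefl of_real_eq_1_iff uminus_add_conv_diff add.commute)
    moreover have "of_real Q * - complex_of_real (Q ^ Suc n) = - of_real (Q ^ Suc (Suc n))" by simp
    ultimately show ?case
      using Suc qExp_functional_eq[of "- of_real (Q ^ Suc n)"] by simp
  qed (use 0 in simp)
  moreover have "(\<lambda>n. qExp Q (- of_real (Q ^ Suc n))) \<longlonglongrightarrow> qExp Q (- of_real 0)"
    using Q by (intro isCont_tendsto_compose[OF isCont_qExp] tendsto_minus tendsto_of_real
        LIMSEQ_Suc LIMSEQ_power_zero) auto
  ultimately have "(\<lambda>n. 0 :: complex) \<longlonglongrightarrow> 1" by (simp add: qExp_0)
  then show False by (simp add: LIMSEQ_const_iff)
qed

end

lemma le_geometric_imp_nonpos: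
  fixes x M r :: real
  assumes "\<And>j. x \<le> r ^ j * M" "0 \<le> r" "r < 1"
  shows "x \<le> 0"
proof -
  have "(\<lambda>j. r ^ j * M) \<longlonglongrightarrow> 0 * M"
    using assms by (intro tendsto_mult LIMSEQ_power_zero tendsto_const) auto
  then show ?thesis using LIMSEQ_le_const[of _ "0 * M" x] assms(1) by auto
qed

section \<open>Determinacy of the moment problem on the lattice\<close>

context jackson_lattice
begin

text \<open>The outermost atoms dominate the \<open>j\<close>-th moment as \<open>j \<rightarrow> \<infinity>\<close>; the parity of \<open>j\<close>
  separates \<open>R\<close> from \<open>-R\<close>.\<close>

lemma top_atoms_eq_0:
  fixes c :: "int \<times> real \<Rightarrow> complex"
  assumes sm: "(\<lambda>p. norm (c p)) summable_on Lat"
    and out: "\<And>p. p \<in> Lat \<Longrightarrow> fst p < N \<Longrightarrow> c p = 0"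
    and mom: "\<And>j. infsum (\<lambda>p. c p * pt p ^ j) Lat = 0"
  shows "c (N, 1) = 0" "c (N, -1) = 0"
proof -
  define R where "R = q powi N * \<gamma>"
  have R: "R > 0" using q_pos \<gamma>_pos by (simp add: R_def)
  define A where "A = {(N, 1), (N, -1 :: real)}"
  have A: "A \<subseteq> Lat" "finite A" by (auto simp: A_def Lat_def)
  have pt_top: "pt (N, 1) = R" "pt (N, -1) = - R" by (auto simp: pt_def wt_def R_def)
  \<comment> \<open>Rescaled so that the two top atoms lie at 1 and -1, while all other points that
    can carry mass have modulus at most q.\<close>
  define z where "z p = pt p / of_real R" for p
  define M where "M = infsum (\<lambda>p. norm (c p)) (Lat - A)"
  have smA: "(\<lambda>p. norm (c p)) summable_on (Lat - A)"
    by (rule summable_on_subset_banach[OF sm]) auto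
  have wt_eq: "wt p = q powi (fst p - N) * R" for p
    using q_pos by (simp add: wt_def R_def power_int_diff)
  have term_le: "norm (c p * z p ^ j) \<le> q ^ j * norm (c p)" if "p \<in> Lat - A" for p j
  proof (cases "fst p < N")
    case False
    with that have "fst p \<noteq> N" by (cases p) (auto simp: A_def Lat_def)
    with False have ge: "fst p - N \<ge> 1" by simp
    have "norm (z p) = q powi (fst p - N)"
      using that R by (simp add: z_def norm_divide norm_pt wt_eq)
    also have "\<dots> \<le> q powi 1"
      using ge q_pos q_lt_1 by (intro power_int_decreasing) auto
    finally have "norm (z p) ^ j \<le> q ^ j" by (intro power_mono) auto
    then have "norm (z p) ^ j * norm (c p) \<le> q ^ j * norm (c p)" by (rule mult_right_mono) simp
    then show ?thesis by (simp add: norm_mult norm_power mult.commute)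
  qed (use out that in auto)
  have z_le: "norm (c p * z p ^ j) \<le> norm (c p)" if "p \<in> Lat" for p j
  proof (cases "p \<in> A")
    case True
    then have "norm (z p) = 1" using R by (auto simp: A_def z_def pt_top)
    then show ?thesis by (simp add: norm_mult norm_power)
  next
    case False
    then have "norm (c p * z p ^ j) \<le> q ^ j * norm (c p)" using term_le that by blast
    also have "\<dots> \<le> 1 * norm (c p)"
      using q_pos q_lt_1 by (intro mult_right_mono power_le_one) auto
    finally show ?thesis by simp
  qed
  have smz: "(\<lambda>p. norm (c p * z p ^ j)) summable_on Lat" for j
    by (rule Infinite_Sum.abs_summable_on_comparison_test'[OF sm]) (rule z_le)
  have momz: "infsum (\<lambda>p. c p * z p ^ j) Lat = 0" for j
  proof -
    have "infsum (\<lambda>p. c p * z p ^ j) Lat = infsum (\<lambda>p. c p * pt p ^ j * (1 / of_real R ^ j)) Lat"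
      by (simp add: z_def power_divide)
    also have "\<dots> = 0" unfolding infsum_cmult_left' mom by simp
    finally show ?thesis .
  qed
  \<comment> \<open>The whole moment vanishes, so the top atoms cancel the rest, which is at most
    q^j times its total mass M.\<close>
  have bound: "norm (c (N, 1) + c (N, -1) * (-1) ^ j) \<le> q ^ j * M" for j
  proof -
    have "infsum (\<lambda>p. c p * z p ^ j) (Lat - A)
        = infsum (\<lambda>p. c p * z p ^ j) Lat - infsum (\<lambda>p. c p * z p ^ j) A"
      using A smz[of j] by (intro infsum_Diff abs_summable_summable[OF smz]) auto
    also have "\<dots> = - (c (N, 1) + c (N, -1) * (-1) ^ j)"
      using momz[of j] R by (simp add: A_def z_def pt_top)
    finally have "norm (c (N, 1) + c (N, -1) * (-1) ^ j) = norm (infsum (\<lambda>p. c p * z p ^ j) (Lat - A))"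
      by (simp only: norm_minus_cancel)
    also have "\<dots> \<le> infsum (\<lambda>p. norm (c p * z p ^ j)) (Lat - A)"
      by (intro norm_infsum_bound summable_on_subset_banach[OF smz]) auto
    also have "\<dots> \<le> infsum (\<lambda>p. q ^ j * norm (c p)) (Lat - A)"
      by (intro infsum_mono summable_on_cmult_right smA summable_on_subset_banach[OF smz] term_le) auto
    finally show ?thesis by (simp add: infsum_cmult_right' M_def)
  qed
  have "norm (c (N, 1) + c (N, -1)) \<le> 0"
    using bound[of "2 * j" for j] q_pos q_lt_1
    by (intro le_geometric_imp_nonpos[of _ "q ^ 2" M]) (auto simp: power_mult power_less_one_iff)
  moreover have "norm (c (N, 1) - c (N, -1)) \<le> 0"
  proof (rule le_geometric_imp_nonpos[of _ "q ^ 2" "q * M"])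
    show "norm (c (N, 1) - c (N, -1)) \<le> (q ^ 2) ^ j * (q * M)" for j
    proof -
      have "(-1 :: complex) ^ Suc (2 * j) = -1" "q ^ Suc (2 * j) = (q ^ 2) ^ j * q"
        by (simp_all flip: power_mult)
      then show ?thesis using bound[of "Suc (2 * j)"] by (simp only: mult.assoc) simp
    qed
  qed (use q_pos q_lt_1 in \<open>auto simp: power_less_one_iff\<close>)
  ultimately have "c (N, 1) + c (N, -1) = 0" "c (N, 1) - c (N, -1) = 0" by auto
  then show "c (N, 1) = 0" "c (N, -1) = 0" by auto
qed

text \<open>Removing the normalisation q^((m^2+m)/2) replaces \<alpha> by \<alpha> - 1, so for
  \<alpha> < 1 the raw absolute moments may grow like an inverse Gaussian.\<close>

lemma amom_bound:
  assumes "\<And>e. abs_qmoment q \<gamma> e f \<le> C * (q powr (\<alpha> * real e ^ 2 / 2) * b ^ e)"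
  shows "amom m f \<le> C / (1 - q) * (q powr ((\<alpha> - 1) * real m ^ 2 / 2 - real m / 2) * b ^ m)"
proof -
  have "q ^ ((m\<^sup>2 + m) div 2) = q powr ((real m ^ 2 + real m) / 2)"
    using q_pos by (simp only: powr_realpow[OF q_pos, symmetric] real_triangle_plus)
  then have "amom m f = abs_qmoment q \<gamma> m f * (q powr (- ((real m ^ 2 + real m) / 2)) / (1 - q))"
    using q_pos q_lt_1 by (simp add: abs_qmoment_eq powr_minus)
  also have "\<dots> \<le> C * (q powr (\<alpha> * real m ^ 2 / 2) * b ^ m) * (q powr (- ((real m ^ 2 + real m) / 2)) / (1 - q))"
    using q_pos q_lt_1 by (intro mult_right_mono assms) auto
  also have "\<dots> = C / (1 - q) * ((q powr (\<alpha> * real m ^ 2 / 2) * q powr (- ((real m ^ 2 + real m) / 2))) * b ^ m)"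
    by simp
  also have "q powr (\<alpha> * real m ^ 2 / 2) * q powr (- ((real m ^ 2 + real m) / 2))
      = q powr ((\<alpha> - 1) * real m ^ 2 / 2 - real m / 2)"
    unfolding powr_add[symmetric] by (rule arg_cong[of _ _ "(powr) q"]) (simp add: field_simps)
  finally show ?thesis .
qed

text \<open>Test against \<open>\<Phi>(x) = E\<^bsub>q\<^sup>2\<^esub>(-q\<^sup>2 x\<^sup>2 / R\<^sup>2)\<close>, which vanishes at the lattice
  points beyond \<open>\<plusminus>R\<close> but not at \<open>\<plusminus>R\<close>. Its \<open>2e\<close>-th coefficient has size \<open>q\<^bsup>e\<^sup>2\<^esup>\<close> up to
  exponential factors, so \<open>\<alpha> > 1/2\<close> is exactly what makes the interchange with the moments legitimate.\<close>

lemma zero_moments_imp_zero: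
  assumes inf: "f \<in> I_inf q \<gamma>" and \<alpha>: "\<alpha> > 1/2" and b: "b > 0"
    and O: "(\<lambda>e. abs_qmoment q \<gamma> e f) \<in> O(\<lambda>e. q powr (\<alpha> * real e ^ 2 / 2) * b ^ e)"
    and mom: "\<And>k. qmoment q \<gamma> k f = 0"
    and x: "x \<in> qlattice q \<gamma>"
  shows "f x = 0"
proof -
  obtain N s where Ns: "(N, s) \<in> Lat" "x = pt (N, s)" using x by (auto simp: qlattice_eq)
  obtain C where C: "C > 0" "\<And>e. abs_qmoment q \<gamma> e f \<le> C * (q powr (\<alpha> * real e ^ 2 / 2) * b ^ e)"
    using abs_moment_bound[OF O b] by blast
  define R where "R = q powi N * \<gamma>"
  have R: "R > 0" using q_pos \<gamma>_pos by (simp add: R_def)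
  define Q where "Q = q ^ 2"
  have Q: "0 < Q" "Q < 1" using q_pos q_lt_1 by (auto simp: Q_def power_less_one_iff)
  \<comment> \<open>The factor Q puts the first zero, argument -1, at |x| = R/q, one lattice step
    beyond R; at |x| = R the argument is -Q, which is not a zero.\<close>
  define \<Phi> where "\<Phi> x = qExp Q (- (of_real (Q / R\<^sup>2) * x\<^sup>2))" for x :: complex
  define d where "d e = Q ^ (e * (e - 1) div 2) * (- (Q / R\<^sup>2)) ^ e / qpoch Q Q e" for e
  define D where "D = Q / R\<^sup>2 * (1 / (1 - Q))"
  have D: "D > 0" using Q R by (simp add: D_def)
  have d_le: "\<bar>d e\<bar> \<le> q powr (real e ^ 2 - real e) * D ^ e" for e
  proof -
    have "Q ^ (e * (e - 1) div 2) = q powr (real (2 * (e * (e - 1) div 2)))"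
      using q_pos unfolding Q_def power_mult[symmetric] by (simp only: powr_realpow)
    also have "real (2 * (e * (e - 1) div 2)) = real e ^ 2 - real e"
      unfolding of_nat_mult real_triangle_minus by simp
    finally have pow: "Q ^ (e * (e - 1) div 2) = q powr (real e ^ 2 - real e)" .
    have "\<bar>d e\<bar> = Q ^ (e * (e - 1) div 2) * (Q / R\<^sup>2) ^ e * (1 / qpoch Q Q e)"
      using Q qpoch_pos[OF Q, of e] by (simp add: d_def abs_mult power_abs)
    also have "\<dots> \<le> Q ^ (e * (e - 1) div 2) * (Q / R\<^sup>2) ^ e * (1 / (1 - Q)) ^ e"
      using Q by (intro mult_left_mono inverse_qpoch_le) auto
    finally show ?thesis unfolding pow D_def by (simp only: power_mult_distrib mult.assoc)
  qed
  define F where "F j e p = of_real (d e) * (wt p *\<^sub>R (f (pt p) * pt p ^ (j + 2 * e)))" for j e p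
  have normF: "norm (F j e p) = \<bar>d e\<bar> * (wt p ^ Suc (j + 2 * e) * norm (f (pt p)))" if "p \<in> Lat" for j e p
    using wt_norm_moment[OF that, of f "j + 2 * e"] by (simp add: F_def norm_mult)
  have 1: "(\<lambda>p. norm (F j e p)) summable_on Lat" for j e
    using summable_on_cmult_right[OF I_infD[OF inf, of "j + 2 * e"], of "\<bar>d e\<bar>"]
    by (simp only: normF cong: summable_on_cong)
  have int: "infsum (\<lambda>p. norm (F j e p)) Lat = \<bar>d e\<bar> * amom (j + 2 * e) f" for j e
    unfolding amom_def by (simp only: normF infsum_cmult_right' cong: infsum_cong)
  have 2: "summable (\<lambda>e. infsum (\<lambda>p. norm (F j e p)) Lat)" for j
  proof (rule summable_comparison_test')
    \<comment> \<open>Exponents quadratic in e: e^2 from \<open>d\<close> and (\<alpha> - 1)(2e)^2/2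
      from \<open>amom_bound\<close> add up to (2\<alpha> - 1)e^2 = a e^2/2. The terms linear in e
      go into \<open>B\<close>, those free of e into \<open>K\<close>.\<close>
    define a where "a = 2 * (2 * \<alpha> - 1)"
    define B where "B = q powr (2 * real j * (\<alpha> - 1) - 2) * b ^ 2 * D"
    define K where "K = C / (1 - q) * (q powr ((\<alpha> - 1) * real j ^ 2 / 2 - real j / 2) * b ^ j)"
    show "summable (\<lambda>e. K * (q powr (a * real e ^ 2 / 2) * B ^ e))"
      using \<alpha> b D q_pos q_lt_1
      by (intro summable_mult summable_gauss) (auto simp: a_def B_def)
    fix e :: nat assume "e \<ge> 0"
    let ?m = "real (j + 2 * e)"
    have exps: "q powr (real e ^ 2 - real e) * q powr ((\<alpha> - 1) * ?m ^ 2 / 2 - ?m / 2)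
        = q powr ((\<alpha> - 1) * real j ^ 2 / 2 - real j / 2) * q powr (a * real e ^ 2 / 2)
          * (q powr (2 * real j * (\<alpha> - 1) - 2)) ^ e"
    proof -
      have "(q powr (2 * real j * (\<alpha> - 1) - 2)) ^ e = q powr ((2 * real j * (\<alpha> - 1) - 2) * real e)"
        using q_pos by (simp add: powr_powr flip: powr_realpow)
      moreover have "real e ^ 2 - real e + ((\<alpha> - 1) * ?m ^ 2 / 2 - ?m / 2)
          = ((\<alpha> - 1) * real j ^ 2 / 2 - real j / 2) + a * real e ^ 2 / 2
            + (2 * real j * (\<alpha> - 1) - 2) * real e"
        unfolding a_def by (simp add: power2_eq_square field_simps)
      ultimately show ?thesis by (simp only: powr_add[symmetric])
    qed
    have "\<bar>d e\<bar> * amom (j + 2 * e) f \<le> (q powr (real e ^ 2 - real e) * D ^ e) *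
        (C / (1 - q) * (q powr ((\<alpha> - 1) * ?m ^ 2 / 2 - ?m / 2) * b ^ (j + 2 * e)))"
      using D by (intro mult_mono d_le amom_bound[OF C(2)] amom_nonneg) auto
    also have "\<dots> = (q powr (real e ^ 2 - real e) * q powr ((\<alpha> - 1) * ?m ^ 2 / 2 - ?m / 2))
        * (D ^ e * b ^ (j + 2 * e) * (C / (1 - q)))"
      by (simp only: mult_ac)
    also have "\<dots> = K * (q powr (a * real e ^ 2 / 2) * B ^ e)"
      unfolding exps K_def B_def by (simp add: power_mult_distrib power_add power_mult power2_eq_square mult_ac)
    finally show "norm (infsum (\<lambda>p. norm (F j e p)) Lat) \<le> K * (q powr (a * real e ^ 2 / 2) * B ^ e)"
      unfolding int using amom_nonneg by simp
  qed
  define c where "c p = wt p *\<^sub>R (f (pt p) * \<Phi> (pt p))" for p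
  have sumF: "suminf (\<lambda>e. F j e p) = c p * pt p ^ j" for j p
  proof -
    let ?x = "- (of_real (Q / R\<^sup>2) * (pt p)\<^sup>2)"
    have "F j e p = (of_real (wt p) * f (pt p) * pt p ^ j) *
       (of_real (Q ^ (e * (e - 1) div 2)) * ?x ^ e / of_real (qpoch Q Q e))" for e
    proof -
      have "?x ^ e = of_real ((- (Q / R\<^sup>2)) ^ e) * pt p ^ (2 * e)"
        by (simp only: power_mult power_mult_distrib[symmetric] of_real_power of_real_minus mult_minus_left)
      then show ?thesis
        unfolding F_def d_def by (simp add: scaleR_conv_of_real power_add mult_ac)
    qed
    then have "(\<lambda>e. F j e p) sums (of_real (wt p) * f (pt p) * pt p ^ j * qExp Q ?x)"
      using sums_mult[OF qExp_sums[OF Q, of ?x]] by presburger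
    then show ?thesis by (simp add: sums_iff c_def \<Phi>_def scaleR_conv_of_real mult_ac)
  qed
  have c_sm: "(\<lambda>p. norm (c p)) summable_on Lat"
    using series_infsum_abs_summable[of "F 0" Lat, OF 1 2] by (simp add: sumF)
  have c_mom: "infsum (\<lambda>p. c p * pt p ^ j) Lat = 0" for j
  proof -
    have "infsum (\<lambda>p. wt p *\<^sub>R (f (pt p) * pt p ^ k)) Lat = 0" for k
      using mom[of k] q_pos q_lt_1 by (simp add: qmoment_def jackson_integral_eq)
    then have "infsum (F j e) Lat = 0" for e
      unfolding F_def infsum_cmult_right' by simp
    then show ?thesis
      using series_infsum_swap[of "F j" Lat, OF 1 2] by (simp add: sumF sums_iff)
  qed
  have pt_sq: "(pt p)\<^sup>2 = of_real ((q powi (fst p - N))\<^sup>2 * R\<^sup>2)" if "p \<in> Lat" for p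
    using that q_pos by (auto simp: pt_def wt_def R_def Lat_def power_int_diff power_mult_distrib field_simps)
  have \<Phi>_pt: "\<Phi> (pt p) = qExp Q (- of_real (Q * (q powi (fst p - N))\<^sup>2))" if "p \<in> Lat" for p
    using R unfolding \<Phi>_def pt_sq[OF that] of_real_mult[symmetric] by simp
  have c_out: "c p = 0" if "p \<in> Lat" "fst p < N" for p
  proof -
    define m where "m = nat (N - fst p - 1)"
    have "fst p - N = - int (Suc m)" using that by (simp add: m_def)
    then have "q powi (fst p - N) = inverse (q ^ Suc m)"
      by (simp only: power_int_minus power_int_of_nat)
    moreover have "Q * (inverse (q ^ Suc m))\<^sup>2 = 1 / Q ^ m"
      using q_pos by (simp add: Q_def power2_eq_square power_mult_distrib field_simps)
    ultimately have "Q * (q powi (fst p - N))\<^sup>2 = 1 / Q ^ m" by (simp only:)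
    then have "\<Phi> (pt p) = 0" using \<Phi>_pt[OF that(1)] qExp_eq_0[OF Q, of m] by simp
    then show ?thesis by (simp add: c_def)
  qed
  have "c (N, 1) = 0" "c (N, -1) = 0"
    using top_atoms_eq_0[of c N] c_sm c_out c_mom by blast+
  with Ns have "c (N, s) = 0" by (auto simp: Lat_def)
  moreover have "\<Phi> (pt (N, s)) \<noteq> 0"
    using \<Phi>_pt[OF Ns(1)] qExp_neq_0[OF Q] by simp
  ultimately show "f x = 0" by (simp add: c_def Ns(2))
qed

lemma qFourier_injective:
  assumes f: "f \<in> HS_I_s_omega_half q \<gamma>"
  shows "(\<forall>y. qFourier q \<gamma> f y = 0) \<longleftrightarrow> (\<forall>x \<in> qlattice q \<gamma>. f x = 0)"
proof
  obtain \<alpha> b where inf: "f \<in> I_inf q \<gamma>" and ab: "\<alpha> > 1/2" "b > 0"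
    and O: "(\<lambda>e. abs_qmoment q \<gamma> e f) \<in> O(\<lambda>e. q powr (\<alpha> * real e ^ 2 / 2) * b ^ e)"
    using f unfolding HS_I_s_omega_half_def by blast
  from ab(1) have "\<alpha> > 0" by simp
  with inf ab(2) O have s: "f \<in> I_s_omega q \<gamma>" unfolding I_s_omega_def by blast
  assume "\<forall>y. qFourier q \<gamma> f y = 0"
  then have "\<forall>y. qFourier_series q \<gamma> f y = 0" using qFourier_eq_series(2)[OF s] by simp
  then have "\<forall>k. qmoment q \<gamma> k f = 0"
    using qFourier_series_eq_0_iff s I_s_omega_subset by blast
  then show "\<forall>x \<in> qlattice q \<gamma>. f x = 0" using zero_moments_imp_zero[OF inf ab O] by blast
next
  assume "\<forall>x \<in> qlattice q \<gamma>. f x = 0"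
  then show "\<forall>y. qFourier q \<gamma> f y = 0"
    by (auto simp: qFourier_def jackson_integral_eq qFourier_integrand_def qlattice_eq intro!: infsum_0)
qed

end

section \<open>The q-derivative on the lattice\<close>

lemma qderiv_eq:
  "x \<noteq> 0 \<Longrightarrow> qderiv q u x = (u x - u (of_real q * x)) / (of_real (1 - q) * x)"
  by (simp add: qderiv_def Let_def)

section \<open>The q-derivative of a holomorphic germ\<close>

context
  fixes q :: real
  assumes q: "0 < q" "q < 1"
begin

text \<open>The numerator vanishes at 0, so the quotient has a removable singularity there, and
  \<open>qderiv\<close> assigns the limit. The disc need not shrink because qz stays in it.\<close>

lemma holomorphic_qderiv:
  assumes h: "h holomorphic_on ball 0 r" and r: "r > 0"
  shows "qderiv q h holomorphic_on ball 0 r"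
proof -
  define F where "F z = (h z - h (of_real q * z)) / of_real (1 - q)" for z
  \<comment> \<open>Since F 0 = 0, this is the q-difference quotient for z \<noteq> 0.\<close>
  define G where "G z = (if z = 0 then deriv F 0 else (F z - F 0) / (z - 0))" for z
  have "of_real q * z \<in> ball 0 r" if "z \<in> ball 0 r" for z :: complex
  proof -
    have "q * norm z \<le> 1 * norm z" using q by (intro mult_right_mono) auto
    then show ?thesis using that q by (simp add: norm_mult)
  qed
  then have "(\<lambda>z. h (of_real q * z)) holomorphic_on ball 0 r"
    by (intro holomorphic_on_compose_gen[OF _ h, unfolded o_def] holomorphic_intros) auto
  then have "F holomorphic_on ball 0 r"
    unfolding F_def using q by (intro holomorphic_intros h) auto
  then have G: "G holomorphic_on ball 0 r"
    unfolding G_def[abs_def] by (rule pole_lemma_open) simp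
  have D_eq: "G z = (h z - h (of_real q * z)) / (of_real (1 - q) * z)" if "z \<noteq> 0" for z
    using that by (simp add: G_def F_def)
  have "isCont G 0"
    using holomorphic_on_imp_continuous_on[OF G] r by (simp add: continuous_on_interior)
  then have "(G \<longlongrightarrow> G 0) (at 0)" by (simp add: isCont_def)
  then have "((\<lambda>z. (h z - h (of_real q * z)) / (of_real (1 - q) * z)) \<longlongrightarrow> G 0) (at 0)"
    by (rule Lim_transform_eventually) (auto simp: eventually_at_filter D_eq)
  then have "qderiv q h 0 = G 0" by (simp add: qderiv_def Let_def tendsto_Lim)
  then have "qderiv q h z = G z" for z
    by (cases "z = 0") (simp_all add: qderiv_eq D_eq)
  then show ?thesis using G by (simp add: fun_eq_iff cong: holomorphic_cong)
qed

text \<open>On the circle |w| = \<rho> the numerator is at most 2B and the denominator has modulus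
  (1-q)\<rho>. The maximum principle carries the bound inward, past the small z where the quotient
  itself gives nothing. The radius is kept, so the estimate can be iterated.\<close>

lemma norm_qderiv_le:
  assumes h: "h holomorphic_on ball 0 r" and \<rho>: "0 < \<rho>" "\<rho> < r"
    and B: "\<And>z. norm z \<le> \<rho> \<Longrightarrow> norm (h z) \<le> B" and z: "norm z \<le> \<rho>"
  shows "norm (qderiv q h z) \<le> 2 / ((1 - q) * \<rho>) * B"
proof (rule maximum_modulus_frontier[where f = "qderiv q h" and S = "cball 0 \<rho>"])
  have hol: "qderiv q h holomorphic_on ball 0 r"
    using \<rho> by (intro holomorphic_qderiv h) auto
  show "qderiv q h holomorphic_on interior (cball 0 \<rho>)"
    by (rule holomorphic_on_subset[OF hol]) (use \<rho> in auto)
  have "cball 0 \<rho> \<subseteq> ball (0::complex) r" using \<rho> by auto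
  then show "continuous_on (closure (cball 0 \<rho>)) (qderiv q h)"
    using holomorphic_on_imp_continuous_on[OF hol] continuous_on_subset by fastforce
  fix w :: complex assume "w \<in> frontier (cball 0 \<rho>)"
  then have w: "norm w = \<rho>" using \<rho> by (simp add: frontier_cball)
  have "norm (of_real q * w) \<le> \<rho>" using q w \<rho> by (simp add: norm_mult mult_left_le_one_le)
  then have "norm (h w - h (of_real q * w)) \<le> 2 * B"
    using norm_triangle_ineq4[of "h w" "h (of_real q * w)"] B[of w] B[of "of_real q * w"] w by simp
  moreover have "norm (of_real (1 - q) * w) = (1 - q) * \<rho>"
    using q w by (simp only: norm_mult norm_of_real)
  moreover have "w \<noteq> 0" using w \<rho> by auto
  ultimately show "norm (qderiv q h w) \<le> 2 / ((1 - q) * \<rho>) * B"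
    using q \<rho> by (simp add: qderiv_eq norm_divide divide_right_mono)
qed (use z in auto)

end

section \<open>Joint control of a lattice function and its germ\<close>

context jackson_lattice
begin

text \<open>Multiplication by q, seen on indices. As a bijection of \<open>Lat\<close> it is the
  change of variables behind every summation by parts.\<close>

definition sh :: "int \<times> real \<Rightarrow> int \<times> real" where "sh p = (fst p + 1, snd p)"

lemma bij_sh: "bij_betw sh Lat Lat"
  by (rule bij_betwI[of _ _ _ "\<lambda>p. (fst p - 1, snd p)"]) (auto simp: sh_def Lat_def)

lemma sh_Lat: "p \<in> Lat \<Longrightarrow> sh p \<in> Lat"
  by (auto simp: sh_def Lat_def)

lemma wt_sh: "wt (sh p) = q * wt p"
  using q_pos by (simp add: wt_def sh_def power_int_add)

lemma pt_sh: "pt (sh p) = of_real q * pt p"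
  by (simp add: pt_def wt_sh) (simp add: sh_def)

lemma qderiv_pt:
  "p \<in> Lat \<Longrightarrow> qderiv q u (pt p) = (u (pt p) - u (pt (sh p))) / (of_real (1 - q) * pt p)"
  by (simp add: qderiv_eq pt_neq_0 pt_sh)

text \<open>The weight |x|^(m+1) cut off to |x| \<le> q^k0 \<gamma>. Its total mass, a geometric
  series for each sign, converts a sup bound near 0 into an l1 bound.\<close>

definition near_wt :: "int \<Rightarrow> nat \<Rightarrow> int \<times> real \<Rightarrow> real" where
  "near_wt k0 m p = (if fst p \<ge> k0 then wt p ^ Suc m else 0)"

lemma near_wt_nonneg: "near_wt k0 m p \<ge> 0"
  by (simp add: near_wt_def)

lemma summable_near_wt: "near_wt k0 m summable_on Lat"
proof -
  have half: "near_wt k0 m summable_on (range (\<lambda>n::nat. (k0 + int n, s)))" for s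
  proof -
    have "near_wt k0 m (k0 + int n, s) = (q powi k0 * \<gamma>) ^ Suc m * (q ^ Suc m) ^ n" for n
    proof -
      have "wt (k0 + int n, s) = (q powi k0 * \<gamma>) * q ^ n"
        using q_pos by (simp add: wt_def power_int_add)
      then show ?thesis
        by (simp only: near_wt_def fst_conv power_mult_distrib power_mult[symmetric] mult.commute[of n]) simp
    qed
    moreover have "summable (\<lambda>n. (q powi k0 * \<gamma>) ^ Suc m * (q ^ Suc m) ^ n)"
      using q_pos q_lt_1 power_Suc_less_one[of q m]
      by (intro summable_mult summable_geometric) (simp del: power_Suc)
    ultimately have "summable (\<lambda>n. near_wt k0 m (k0 + int n, s))" by simp
    then have "(\<lambda>n. near_wt k0 m (k0 + int n, s)) summable_on UNIV"
      by (simp add: summable_on_UNIV_nonneg_real_iff near_wt_nonneg)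
    then show ?thesis
      by (subst summable_on_reindex) (auto simp: inj_on_def o_def)
  qed
  define S where "S = range (\<lambda>n::nat. (k0 + int n, 1 :: real)) \<union> range (\<lambda>n::nat. (k0 + int n, -1))"
  have "near_wt k0 m summable_on S"
    unfolding S_def by (intro summable_on_Un_disjoint half) auto
  moreover have "S \<subseteq> Lat" by (auto simp: S_def Lat_def)
  moreover have "near_wt k0 m p = 0" if "p \<in> Lat - S" for p
  proof -
    have "\<not> fst p \<ge> k0"
    proof
      assume "fst p \<ge> k0"
      then obtain n where "fst p = k0 + int n" using zle_iff_zadd by blast
      with that show False by (cases p) (auto simp: S_def Lat_def)
    qed
    then show ?thesis by (simp add: near_wt_def)
  qed
  ultimately show ?thesis
    using summable_on_cong_neutral[of Lat S "near_wt k0 m" "near_wt k0 m"] by blast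
qed

text \<open>Only \<open>u\<close> restricted to the lattice matters; \<open>h\<close> is its holomorphic germ at \<open>0\<close>. A common
  bound \<open>C\<close> for both makes the estimate stable under \<open>q\<close>-differentiation.\<close>

definition ctrl :: "real \<Rightarrow> int \<Rightarrow> nat \<Rightarrow> (complex \<Rightarrow> complex) \<Rightarrow> (complex \<Rightarrow> complex) \<Rightarrow> real \<Rightarrow> bool" where
  "ctrl r k0 m u h C \<longleftrightarrow> h holomorphic_on ball 0 r \<and> (\<forall>z. norm z \<le> q powi k0 * \<gamma> \<longrightarrow> norm (h z) \<le> C) \<and>
     (\<forall>p \<in> Lat. wt p < r \<longrightarrow> u (pt p) = h (pt p)) \<and>
     (\<lambda>p. wt p ^ Suc m * norm (u (pt p))) summable_on Lat \<and> amom m u \<le> C"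

text \<open>With R = q^k0 \<gamma>, the constant 2/((1-q)R) comes from the maximum principle: the 1
  beside it serves the sup norm of the germ, the infinite sum serves the inner lattice points. The
  last summand is the division by (1-q)x outside radius R, where 1/q^(m+1) rescales the weight of
  the shifted term.\<close>

definition ctrl_factor :: "int \<Rightarrow> nat \<Rightarrow> real" where
  "ctrl_factor k0 m = 2 / ((1 - q) * (q powi k0 * \<gamma>)) * (1 + infsum (near_wt k0 m) Lat)
     + 1 / ((1 - q) * (q powi k0 * \<gamma>)) * (1 + 1 / q ^ Suc m)"

lemma ctrl_factor_nonneg: "ctrl_factor k0 m \<ge> 0"
proof -
  have "infsum (near_wt k0 m) Lat \<ge> 0" by (intro infsum_nonneg near_wt_nonneg)
  then show ?thesis
    using q_pos q_lt_1 \<gamma>_pos unfolding ctrl_factor_def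
    by (intro add_nonneg_nonneg mult_nonneg_nonneg divide_nonneg_nonneg) auto
qed

text \<open>Near \<open>0\<close> the quotient is controlled by the maximum principle, away from \<open>0\<close> by the
  division by \<open>\<bar>x\<bar> \<ge> q\<^bsup>k0\<^esup>\<gamma>\<close>.\<close>

lemma ctrl_qderiv:
  assumes u: "ctrl r k0 m u h C" and r: "q powi k0 * \<gamma> < r"
  shows "ctrl r k0 m (qderiv q u) (qderiv q h) (ctrl_factor k0 m * C)"
proof -
  define R where "R = q powi k0 * \<gamma>"
  have R: "R > 0" "R < r" using q_pos \<gamma>_pos r by (auto simp: R_def)
  define K where "K = 2 / ((1 - q) * R)"
  define L where "L = 1 / ((1 - q) * R)"
  have K: "K \<ge> 0" and L: "L \<ge> 0" using R q_lt_1 by (auto simp: K_def L_def)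
  have h: "h holomorphic_on ball 0 r" and hC: "\<And>z. norm z \<le> R \<Longrightarrow> norm (h z) \<le> C"
    and uh: "\<And>p. p \<in> Lat \<Longrightarrow> wt p < r \<Longrightarrow> u (pt p) = h (pt p)"
    and sm: "(\<lambda>p. wt p ^ Suc m * norm (u (pt p))) summable_on Lat" and am: "amom m u \<le> C"
    using u by (auto simp: ctrl_def R_def)
  have C: "C \<ge> 0" using amom_nonneg am by (rule order_trans)
  have Dh: "norm (qderiv q h z) \<le> K * C" if "norm z \<le> R" for z
    unfolding K_def using norm_qderiv_le[OF q_pos q_lt_1 h R hC that] .
  define a where "a p = wt p ^ Suc m * norm (u (pt p))" for p
  have a_sh: "(\<lambda>p. a (sh p)) summable_on Lat" "infsum (\<lambda>p. a (sh p)) Lat = amom m u"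
    using sm summable_on_reindex_bij_betw[OF bij_sh, of a] infsum_reindex_bij_betw[OF bij_sh, of a]
    by (simp_all add: a_def[abs_def] amom_def)
  have a_sm: "a summable_on Lat" "infsum a Lat = amom m u"
    using sm by (simp_all add: a_def[abs_def] amom_def)
  \<comment> \<open>The shift moves points towards 0, so agreement with the germ persists on the
    same disc.\<close>
  have agree: "qderiv q u (pt p) = qderiv q h (pt p)" if "p \<in> Lat" "wt p < r" for p
  proof -
    have "wt (sh p) < wt p" using wt_pos[of p] q_lt_1 by (simp add: wt_sh)
    then have "wt (sh p) < r" using that by simp
    then show ?thesis using uh that sh_Lat by (simp add: qderiv_pt)
  qed
  \<comment> \<open>The first summand majorises at the inner points, the second at the outer ones;
    adding them avoids splitting the lattice sum.\<close>
  define b where "b p = K * C * near_wt k0 m p + L * (a p + 1 / q ^ Suc m * a (sh p))" for p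
  have b_sm: "b summable_on Lat"
    unfolding b_def[abs_def]
    by (intro summable_on_add summable_on_cmult_right summable_near_wt a_sm a_sh)
  have b_sum: "infsum b Lat = K * C * infsum (near_wt k0 m) Lat + L * (amom m u + 1 / q ^ Suc m * amom m u)"
  proof -
    have "infsum b Lat = infsum (\<lambda>p. K * C * near_wt k0 m p) Lat
        + infsum (\<lambda>p. L * (a p + 1 / q ^ Suc m * a (sh p))) Lat"
      unfolding b_def[abs_def]
      by (intro infsum_add summable_on_add summable_on_cmult_right summable_near_wt a_sm a_sh)
    also have "infsum (\<lambda>p. L * (a p + 1 / q ^ Suc m * a (sh p))) Lat
        = L * (amom m u + 1 / q ^ Suc m * amom m u)"
      by (simp only: infsum_cmult_right' a_sm a_sh infsum_add[OF a_sm(1) summable_on_cmult_right[OF a_sh(1)]])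
    finally show ?thesis by (simp only: infsum_cmult_right')
  qed
  have le: "wt p ^ Suc m * norm (qderiv q u (pt p)) \<le> b p" if p: "p \<in> Lat" for p
  proof (cases "fst p \<ge> k0")
    case True
    then have "q powi fst p \<le> q powi k0"
      using q_pos q_lt_1 by (intro power_int_decreasing) auto
    then have "wt p \<le> R" using \<gamma>_pos by (simp add: wt_def R_def)
    then have "norm (qderiv q u (pt p)) \<le> K * C"
      using agree[OF p] R Dh[of "pt p"] p by (simp add: norm_pt)
    then have "wt p ^ Suc m * norm (qderiv q u (pt p)) \<le> wt p ^ Suc m * (K * C)"
      by (intro mult_left_mono) auto
    also have "\<dots> = K * C * near_wt k0 m p" using True by (simp add: near_wt_def)
    also have "\<dots> \<le> b p" using L q_pos by (simp add: b_def a_def)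
    finally show ?thesis .
  next
    case False
    then have "q powi k0 \<le> q powi fst p"
      using q_pos q_lt_1 by (intro power_int_decreasing) auto
    then have wR: "R \<le> wt p" using \<gamma>_pos by (simp add: wt_def R_def)
    have "norm (qderiv q u (pt p)) = norm (u (pt p) - u (pt (sh p))) / ((1 - q) * wt p)"
      using q_lt_1 p by (simp only: qderiv_pt[OF p] norm_divide norm_mult norm_of_real norm_pt[OF p])
    also have "\<dots> \<le> (norm (u (pt p)) + norm (u (pt (sh p)))) / ((1 - q) * R)"
      using q_lt_1 R wR by (intro frac_le norm_triangle_ineq4) auto
    finally have "wt p ^ Suc m * norm (qderiv q u (pt p))
        \<le> wt p ^ Suc m * ((norm (u (pt p)) + norm (u (pt (sh p)))) / ((1 - q) * R))"
      by (intro mult_left_mono) auto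
    also have "\<dots> = L * (a p + 1 / q ^ Suc m * a (sh p))"
    proof -
      have "1 / q ^ Suc m * a (sh p) = wt p ^ Suc m * norm (u (pt (sh p)))"
        using q_pos by (simp add: a_def wt_sh power_mult_distrib)
      then show ?thesis unfolding L_def by (simp add: a_def algebra_simps add_divide_distrib)
    qed
    also have "\<dots> \<le> b p" using K C near_wt_nonneg by (simp add: b_def)
    finally show ?thesis .
  qed
  have sm': "(\<lambda>p. wt p ^ Suc m * norm (qderiv q u (pt p))) summable_on Lat"
    by (rule summable_on_comparison_test[OF b_sm]) (use le in auto)
  have const: "ctrl_factor k0 m * C = K * C + (K * C * infsum (near_wt k0 m) Lat + L * (C + 1 / q ^ Suc m * C))"
    unfolding ctrl_factor_def R_def[symmetric] K_def[symmetric] L_def[symmetric]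
    by (simp add: algebra_simps)
  have KC: "K * C \<ge> 0" using K C by simp
  have "amom m (qderiv q u) \<le> infsum b Lat"
    unfolding amom_def by (intro infsum_mono sm' b_sm le)
  also have "\<dots> \<le> K * C * infsum (near_wt k0 m) Lat + L * (C + 1 / q ^ Suc m * C)"
    unfolding b_sum using L am q_pos
    by (intro add_left_mono mult_left_mono add_mono) auto
  also have "\<dots> \<le> ctrl_factor k0 m * C" unfolding const using KC by simp
  finally have am': "amom m (qderiv q u) \<le> ctrl_factor k0 m * C" .
  have "K * C \<le> ctrl_factor k0 m * C"
  proof -
    have "infsum (near_wt k0 m) Lat \<ge> 0" by (intro infsum_nonneg near_wt_nonneg)
    then have "K * C * infsum (near_wt k0 m) Lat + L * (C + 1 / q ^ Suc m * C) \<ge> 0"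
      using K KC L C q_pos by (intro add_nonneg_nonneg mult_nonneg_nonneg) auto
    then show ?thesis unfolding const by simp
  qed
  then have "norm (qderiv q h z) \<le> ctrl_factor k0 m * C" if "norm z \<le> R" for z
    using Dh[OF that] by simp
  moreover have "qderiv q h holomorphic_on ball 0 r"
    using R by (intro holomorphic_qderiv[OF q_pos q_lt_1 h]) auto
  ultimately show ?thesis
    unfolding ctrl_def R_def[symmetric] using agree sm' am' by blast
qed

lemma ctrl_funpow:
  assumes "ctrl r k0 m u h C" "q powi k0 * \<gamma> < r"
  shows "ctrl r k0 m ((qderiv q ^^ e) u) ((qderiv q ^^ e) h) (ctrl_factor k0 m ^ e * C)"
proof (induction e)
  case (Suc e)
  from ctrl_qderiv[OF this assms(2)] show ?case by (simp add: mult.assoc)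
qed (use assms in simp)

text \<open>The closed disc of radius q^k0 \<gamma> fits inside the disc of holomorphy, so
  compactness bounds the germ. One choice of \<open>r\<close>, \<open>k0\<close> and
  \<open>h\<close> serves all moment orders; only the constant \<open>C\<close> depends on
  \<open>m\<close>.\<close>

lemma HD_ctrl:
  assumes g: "g \<in> HD_I_omega q \<gamma>"
  obtains r k0 h where "q powi k0 * \<gamma> < r" "\<forall>m. \<exists>C. ctrl r k0 m g h C"
proof -
  obtain r h where r: "r > 0" and h: "h holomorphic_on ball 0 r"
    and gh: "\<forall>x \<in> qlattice q \<gamma> \<inter> ball 0 r. g x = h x" and inf: "g \<in> I_inf q \<gamma>"
    using g unfolding HD_I_omega_def I_omega_def by blast
  obtain n where "q ^ n < r / \<gamma>" using real_arch_pow_inv[of "r / \<gamma>" q] r \<gamma>_pos q_lt_1 by auto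
  then have kr: "q powi int n * \<gamma> < r" using \<gamma>_pos by (simp add: field_simps)
  have "cball 0 (q powi int n * \<gamma>) \<subseteq> ball (0::complex) r" using kr by auto
  then have "continuous_on (cball 0 (q powi int n * \<gamma>)) h"
    using holomorphic_on_imp_continuous_on[OF h] continuous_on_subset by blast
  then have "bounded (h ` cball 0 (q powi int n * \<gamma>))"
    by (intro compact_imp_bounded compact_continuous_image) auto
  then obtain B where "\<forall>z \<in> cball 0 (q powi int n * \<gamma>). norm (h z) \<le> B"
    by (auto simp: bounded_iff)
  then have B: "norm (h z) \<le> B" if "norm z \<le> q powi int n * \<gamma>" for z using that by auto
  have "ctrl r (int n) m g h (max B (amom m g))" for m
    unfolding ctrl_def using h B gh I_infD[OF inf, of m]
    by (auto simp: qlattice_eq norm_pt intro: max.coboundedI1)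
  with kr that show ?thesis by blast
qed

section \<open>Moments of iterated q-derivatives\<close>

lemma lattice_summable_norm:
  assumes "(\<lambda>p. wt p ^ Suc m * norm (u (pt p))) summable_on Lat"
  shows "(\<lambda>p. norm (wt p *\<^sub>R (u (pt p) * pt p ^ m))) summable_on Lat"
proof -
  have "norm (wt p *\<^sub>R (u (pt p) * pt p ^ m)) = wt p ^ Suc m * norm (u (pt p))" if "p \<in> Lat" for p
    using wt_norm_moment[OF that, of u m] by simp
  with assms show ?thesis by (simp only: cong: summable_on_cong)
qed

text \<open>One factor of x^(m+1) cancels the division by x, so the two halves of the difference are
  summable separately. Reindexing by \<open>sh\<close> yields 1 - q^(-(m+1)), which the extra
  q^(m+1) in the normalisation turns into -(1 - q^(m+1)).\<close>

lemma qmoment_Suc_qderiv: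
  assumes "(\<lambda>p. wt p ^ Suc m * norm (u (pt p))) summable_on Lat"
  shows "qmoment q \<gamma> (Suc m) (qderiv q u) = - of_real ((1 - q ^ Suc m) / (1 - q)) * qmoment q \<gamma> m u"
proof -
  define a where "a p = wt p *\<^sub>R (u (pt p) * pt p ^ m)" for p
  define X where "X = 1 / (1 - q) * (1 - 1 / q ^ Suc m)"
  have a: "a summable_on Lat"
    using lattice_summable_norm[OF assms] unfolding a_def[abs_def] by (rule abs_summable_summable)
  have a_sh: "(\<lambda>p. a (sh p)) summable_on Lat" "infsum (\<lambda>p. a (sh p)) Lat = infsum a Lat"
    using a summable_on_reindex_bij_betw[OF bij_sh, of a] infsum_reindex_bij_betw[OF bij_sh, of a] by simp_all
  have eq: "wt p *\<^sub>R (qderiv q u (pt p) * pt p ^ Suc m)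
      = of_real (1 / (1 - q)) * (a p + of_real (- 1 / q ^ Suc m) * a (sh p))" if p: "p \<in> Lat" for p
    using pt_neq_0[OF p] q_pos q_lt_1
    by (simp add: qderiv_pt[OF p] a_def wt_sh pt_sh[of p] scaleR_conv_of_real power_mult_distrib field_simps)
  have "infsum (\<lambda>p. wt p *\<^sub>R (qderiv q u (pt p) * pt p ^ Suc m)) Lat
      = of_real (1 / (1 - q)) * (infsum a Lat + of_real (- 1 / q ^ Suc m) * infsum a Lat)"
    by (simp only: eq infsum_cmult_right' a_sh infsum_add[OF a summable_on_cmult_right[OF a_sh(1)]]
        cong: infsum_cong)
  also have "\<dots> = of_real X * infsum a Lat"
    by (simp add: X_def algebra_simps)
  finally have int: "infsum (\<lambda>p. wt p *\<^sub>R (qderiv q u (pt p) * pt p ^ Suc m)) Lat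
      = of_real X * infsum a Lat" .
  have tri: "((Suc m)\<^sup>2 + Suc m) div 2 = (m\<^sup>2 + m) div 2 + Suc m"
    using triangle_shift[of "Suc m"] triangle_shift[of m] by (simp add: power2_eq_square algebra_simps)
  have X: "q ^ (((Suc m)\<^sup>2 + Suc m) div 2) * X = - ((1 - q ^ Suc m) / (1 - q)) * q ^ ((m\<^sup>2 + m) div 2)"
    unfolding tri power_add X_def using q_pos q_lt_1 by (simp add: field_simps)
  have "qmoment q \<gamma> (Suc m) (qderiv q u)
      = of_real (q ^ (((Suc m)\<^sup>2 + Suc m) div 2) * X) * (of_real (1 - q) * infsum a Lat)"
    unfolding qmoment_def jackson_integral_eq int by (simp only: scaleR_conv_of_real of_real_mult mult_ac)
  also have "\<dots> = - of_real ((1 - q ^ Suc m) / (1 - q)) * qmoment q \<gamma> m u"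
    unfolding X qmoment_def jackson_integral_eq a_def scaleR_conv_of_real of_real_mult of_real_minus
    by (simp only: mult.assoc)
  finally show ?thesis .
qed

text \<open>Allows an unordered sum over \<open>Lat\<close> to be evaluated along finite symmetric
  boxes, where it telescopes.\<close>

lemma filterlim_lattice_boxes:
  "filterlim (\<lambda>n. {- int n..<int n} \<times> {1, -1}) (finite_subsets_at_top Lat) sequentially"
  unfolding filterlim_finite_subsets_at_top
proof (intro allI impI, elim conjE)
  fix X :: "(int \<times> real) set" assume X: "finite X" "X \<subseteq> Lat"
  obtain N where N: "\<And>p. p \<in> X \<Longrightarrow> nat \<bar>fst p\<bar> < N"
    using finite_nat_bounded[of "(\<lambda>p. nat \<bar>fst p\<bar>) ` X"] X(1) by auto
  show "eventually (\<lambda>n. finite ({- int n..<int n} \<times> {1, -1 :: real}) \<and>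
      X \<subseteq> {- int n..<int n} \<times> {1, -1} \<and> {- int n..<int n} \<times> {1, -1} \<subseteq> Lat) sequentially"
    using eventually_ge_at_top[of N]
  proof eventually_elim
    case (elim n)
    have "p \<in> {- int n..<int n} \<times> {1, -1}" if "p \<in> X" for p
      using N[OF that] X(2) that elim by (cases p) (auto simp: Lat_def)
    then show ?case by (auto simp: Lat_def)
  qed
qed

text \<open>No power of x cancels the division here, so the two halves need not be summable near 0
  and the sum is telescoped. Weight over point is the sign s, hence the inner boundary terms, both
  tending to h 0, enter with opposite signs and cancel. The outer ones tend to 0 by
  summability.\<close>

lemma qmoment_0_qderiv:
  assumes u: "ctrl r k0 0 u h C" and r: "q powi k0 * \<gamma> < r"
  shows "qmoment q \<gamma> 0 (qderiv q u) = 0"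
proof -
  have h: "h holomorphic_on ball 0 r" and uh: "\<And>p. p \<in> Lat \<Longrightarrow> wt p < r \<Longrightarrow> u (pt p) = h (pt p)"
    and sm: "(\<lambda>p. wt p ^ Suc 0 * norm (u (pt p))) summable_on Lat"
    using u by (auto simp: ctrl_def)
  have r0: "r > 0" using r q_pos \<gamma>_pos by (meson less_trans mult_pos_pos zero_less_power_int)
  have sm': "(\<lambda>p. wt p ^ Suc 0 * norm (qderiv q u (pt p))) summable_on Lat"
    using ctrl_qderiv[OF u r] by (simp add: ctrl_def)
  define a where "a p = wt p *\<^sub>R qderiv q u (pt p)" for p
  have "a summable_on Lat"
    by (rule abs_summable_summable) (use lattice_summable_norm[OF sm'] in \<open>simp add: a_def\<close>)
  then have "((\<lambda>X. sum a X) \<longlongrightarrow> infsum a Lat) (finite_subsets_at_top Lat)"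
    unfolding has_sum_def[symmetric] by (rule has_sum_infsum)
  from filterlim_compose[OF this filterlim_lattice_boxes]
  have lim: "(\<lambda>n. sum a ({- int n..<int n} \<times> {1, -1})) \<longlonglongrightarrow> infsum a Lat" .
  have a_eq: "a (k, s) = of_real (s / (1 - q)) * (u (pt (k, s)) - u (pt (k + 1, s)))" if "s \<in> {1, -1}" for k s
  proof -
    have p: "(k, s) \<in> Lat" using that by (auto simp: Lat_def)
    have "of_real (wt (k, s)) / pt (k, s) = of_real s" using that by (auto simp: pt_def)
    moreover have "a (k, s) = of_real (wt (k, s)) / pt (k, s) * (u (pt (k, s)) - u (pt (k + 1, s))) / of_real (1 - q)"
      by (simp add: a_def qderiv_pt[OF p] sh_def scaleR_conv_of_real)
    ultimately show ?thesis by simp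
  qed
  have tele: "(\<Sum>k\<in>{- int n..<int n}. a (k, s))
      = of_real (s / (1 - q)) * (u (pt (- int n, s)) - u (pt (int n, s)))" if s: "s \<in> {1, -1}" for n s
  proof (induction n)
    case (Suc n)
    have "{- int (Suc n)..<int (Suc n)} = insert (- 1 - int n) (insert (int n) {- int n..<int n})" by auto
    then have E: "(\<Sum>k\<in>{- int (Suc n)..<int (Suc n)}. a (k, s))
        = a (- 1 - int n, s) + (a (int n, s) + (\<Sum>k\<in>{- int n..<int n}. a (k, s)))" by simp
    show ?case unfolding E Suc by (simp add: a_eq[OF s] algebra_simps)
  qed simp
  have far: "(\<lambda>n. u (pt (- int n, s))) \<longlonglongrightarrow> 0" if s: "s \<in> {1, -1}" for s
  proof (rule Lim_null_comparison)
    have "(\<lambda>p. wt p ^ Suc 0 * norm (u (pt p))) summable_on range (\<lambda>n. (- int n, s))"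
      by (rule summable_on_subset_banach[OF sm]) (use s in \<open>auto simp: Lat_def\<close>)
    then have "(\<lambda>n. wt (- int n, s) * norm (u (pt (- int n, s)))) summable_on UNIV"
      by (subst (asm) summable_on_reindex) (auto simp: inj_on_def o_def)
    then have "summable (\<lambda>n. wt (- int n, s) * norm (u (pt (- int n, s))))"
      by (rule summable_on_imp_summable)
    from tendsto_mult_right_zero[OF summable_LIMSEQ_zero[OF this], of "1 / \<gamma>"]
    show "(\<lambda>n. 1 / \<gamma> * (wt (- int n, s) * norm (u (pt (- int n, s))))) \<longlonglongrightarrow> 0" .
    have "norm (u (pt (- int n, s))) \<le> 1 / \<gamma> * (wt (- int n, s) * norm (u (pt (- int n, s))))" for n
    proof -
      have "1 \<le> q powi (- int n)"
        using q_pos q_lt_1 by (simp add: power_int_minus one_le_inverse_iff power_le_one)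
      then have "1 * norm (u (pt (- int n, s))) \<le> q powi (- int n) * norm (u (pt (- int n, s)))"
        by (intro mult_right_mono) auto
      then show ?thesis using \<gamma>_pos by (simp add: wt_def)
    qed
    then show "eventually (\<lambda>n. norm (u (pt (- int n, s)))
        \<le> 1 / \<gamma> * (wt (- int n, s) * norm (u (pt (- int n, s))))) sequentially" by simp
  qed
  have wt0: "(\<lambda>n. wt (int n, s)) \<longlonglongrightarrow> 0" for s
    using tendsto_mult_left_zero[OF LIMSEQ_power_zero[of q], of \<gamma>] q_pos q_lt_1 by (simp add: wt_def)
  have near: "(\<lambda>n. u (pt (int n, s))) \<longlonglongrightarrow> h 0" if s: "s \<in> {1, -1}" for s
  proof -
    have "(\<lambda>n. complex_of_real (s * wt (int n, s))) \<longlonglongrightarrow> complex_of_real (s * 0)"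
      by (intro tendsto_of_real tendsto_mult tendsto_const wt0)
    then have "(\<lambda>n. pt (int n, s)) \<longlonglongrightarrow> 0" by (simp add: pt_def)
    moreover have "isCont h 0"
      using holomorphic_on_imp_continuous_on[OF h] r0 by (simp add: continuous_on_interior)
    ultimately have "(\<lambda>n. h (pt (int n, s))) \<longlonglongrightarrow> h 0" by (rule isCont_tendsto_compose[rotated])
    moreover have "eventually (\<lambda>n. wt (int n, s) < r) sequentially"
      using order_tendstoD(2)[OF wt0 r0] .
    then have "eventually (\<lambda>n. h (pt (int n, s)) = u (pt (int n, s))) sequentially"
      by eventually_elim (use uh s in \<open>auto simp: Lat_def\<close>)
    ultimately show ?thesis by (rule Lim_transform_eventually)
  qed
  have "sum a ({- int n..<int n} \<times> {1, -1})
      = of_real (1 / (1 - q)) * (u (pt (- int n, 1)) - u (pt (int n, 1)))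
        + of_real (-1 / (1 - q)) * (u (pt (- int n, -1)) - u (pt (int n, -1)))" for n
  proof -
    have "sum a ({- int n..<int n} \<times> {1, -1}) = (\<Sum>k\<in>{- int n..<int n}. \<Sum>s\<in>{1, -1}. a (k, s))"
      by (subst sum.cartesian_product) simp
    also have "\<dots> = (\<Sum>s\<in>{1, -1}. \<Sum>k\<in>{- int n..<int n}. a (k, s))" by (rule sum.swap)
    also have "\<dots> = (\<Sum>k\<in>{- int n..<int n}. a (k, 1)) + (\<Sum>k\<in>{- int n..<int n}. a (k, -1))" by simp
    finally show ?thesis using tele[of 1 n] tele[of "-1" n] by simp
  qed
  moreover have "(\<lambda>n. of_real (1 / (1 - q)) * (u (pt (- int n, 1)) - u (pt (int n, 1)))
        + of_real (-1 / (1 - q)) * (u (pt (- int n, -1)) - u (pt (int n, -1))))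
      \<longlonglongrightarrow> of_real (1 / (1 - q)) * (0 - h 0) + of_real (-1 / (1 - q)) * (0 - h 0)"
    by (intro tendsto_intros far near) auto
  ultimately have "(\<lambda>n. sum a ({- int n..<int n} \<times> {1, -1})) \<longlonglongrightarrow> 0" by simp
  with lim have "infsum a Lat = 0" using LIMSEQ_unique by blast
  then show ?thesis by (simp add: qmoment_def jackson_integral_eq a_def[abs_def])
qed

text \<open>Each derivative lowers the moment order by one, with a factor -(1 - q^k)/(1 - q) at
  order k, until at order 0 the integral of a q-derivative vanishes. Hence the cutoff e \<le>
  m.\<close>

lemma qmoment_funpow_qderiv:
  assumes u: "\<And>m. \<exists>C. ctrl r k0 m u h C" and r: "q powi k0 * \<gamma> < r"
  shows "qmoment q \<gamma> m ((qderiv q ^^ e) u) = (if e \<le> m then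
      of_real ((-1) ^ e * qpoch q q m / (qpoch q q (m - e) * (1 - q) ^ e)) * qmoment q \<gamma> (m - e) u else 0)"
proof (induction e arbitrary: m)
  case 0
  show ?case using qpoch_pos[OF q_pos q_lt_1, of m] by simp
next
  case (Suc e)
  have ctrl_e: "\<exists>C. ctrl r k0 m ((qderiv q ^^ e) u) ((qderiv q ^^ e) h) C" for m
    using u[of m] ctrl_funpow[OF _ r] by blast
  show ?case
  proof (cases m)
    case 0
    obtain C where "ctrl r k0 0 ((qderiv q ^^ e) u) ((qderiv q ^^ e) h) C" using ctrl_e by blast
    from qmoment_0_qderiv[OF this r] show ?thesis using 0 by simp
  next
    case (Suc m')
    have "(\<lambda>p. wt p ^ Suc m' * norm ((qderiv q ^^ e) u (pt p))) summable_on Lat"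
      using ctrl_e[of m'] by (auto simp: ctrl_def)
    from qmoment_Suc_qderiv[OF this]
    have eq: "qmoment q \<gamma> m ((qderiv q ^^ Suc e) u)
        = - of_real ((1 - q ^ Suc m') / (1 - q)) * qmoment q \<gamma> m' ((qderiv q ^^ e) u)"
      using Suc by simp
    show ?thesis
    proof (cases "e \<le> m'")
      case True
      have "- ((1 - q ^ Suc m') / (1 - q)) * ((-1) ^ e * qpoch q q m' / (qpoch q q (m' - e) * (1 - q) ^ e))
          = (-1) ^ Suc e * qpoch q q (Suc m') / (qpoch q q (Suc m' - Suc e) * (1 - q) ^ Suc e)"
        unfolding qpoch_Suc[OF q_pos q_lt_1] by (simp add: mult_ac)
      from arg_cong[OF this, of complex_of_real] show ?thesis
        unfolding eq Suc.IH using Suc True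
        by (simp only: of_real_mult of_real_minus mult.assoc[symmetric] if_True Suc_le_mono diff_Suc_Suc)
    qed (use Suc eq Suc.IH in simp)
  qed
qed

end

section \<open>Convolution\<close>

lemma qfact_inverse_le:
  assumes "0 < q" "q < 1"
  shows "norm (1 / complex_of_real (qfact q e)) \<le> 1"
proof -
  have "qfact q e \<ge> 1"
    using qpoch_ge[OF assms, of e] assms by (simp add: qfact_def)
  then show ?thesis by (simp add: norm_divide)
qed

text \<open>From m^2 \<le> 2(e^2 + (m-e)^2): splitting m into two parts costs half of the Gaussian
  rate at worst.\<close>

lemma gauss_convolution_le:
  fixes q a1 a2 b1 b2 :: real
  assumes q: "0 < q" "q < 1" and a: "a1 > 0" "a2 > 0" and b: "b1 > 0" "b2 > 0" and e: "e \<le> m"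
  shows "(q powr (a1 * real e ^ 2 / 2) * b1 ^ e) * (q powr (a2 * real (m - e) ^ 2 / 2) * b2 ^ (m - e))
    \<le> q powr (min a1 a2 / 2 * real m ^ 2 / 2) * max b1 b2 ^ m"
proof -
  define a where "a = min a1 a2"
  have "real m ^ 2 \<le> 2 * (real e ^ 2 + real (m - e) ^ 2)"
  proof -
    obtain k where m: "m = e + k" using e le_iff_add by blast
    have eq: "real m ^ 2 + (real e - real k) ^ 2 = 2 * (real e ^ 2 + real k ^ 2)"
      by (simp add: m power2_eq_square algebra_simps)
    have nonneg: "0 \<le> (real e - real k) ^ 2" by simp
    have diff: "m - e = k" by (simp add: m)
    show ?thesis unfolding diff using eq nonneg by linarith
  qed
  then have "a * real m ^ 2 \<le> a * (2 * (real e ^ 2 + real (m - e) ^ 2))"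
    using a by (intro mult_left_mono) (auto simp: a_def)
  moreover have "a * real e ^ 2 \<le> a1 * real e ^ 2" "a * real (m - e) ^ 2 \<le> a2 * real (m - e) ^ 2"
    by (auto simp: a_def intro!: mult_right_mono)
  ultimately have "a / 2 * real m ^ 2 / 2 \<le> a1 * real e ^ 2 / 2 + a2 * real (m - e) ^ 2 / 2"
    by (simp add: algebra_simps)
  then have "q powr (a1 * real e ^ 2 / 2 + a2 * real (m - e) ^ 2 / 2) \<le> q powr (a / 2 * real m ^ 2 / 2)"
    using q by (intro powr_mono') auto
  then have 1: "q powr (a1 * real e ^ 2 / 2) * q powr (a2 * real (m - e) ^ 2 / 2) \<le> q powr (a / 2 * real m ^ 2 / 2)"
    by (simp add: powr_add)
  have "b1 ^ e * b2 ^ (m - e) \<le> max b1 b2 ^ e * max b1 b2 ^ (m - e)"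
    using b by (intro mult_mono power_mono) auto
  then have 2: "b1 ^ e * b2 ^ (m - e) \<le> max b1 b2 ^ m" using e by (simp flip: power_add)
  from mult_mono[OF 1 2] show ?thesis using b unfolding a_def by (simp add: mult_ac)
qed

context jackson_lattice
begin

lemma I_omegaI:
  assumes "f \<in> I_inf q \<gamma>" "a > 0" "b > 0"
    and "\<And>e. norm (qmoment q \<gamma> e f) \<le> C * (q powr (a * real e ^ 2 / 2) * b ^ e)"
  shows "f \<in> I_omega q \<gamma>"
proof -
  have "(\<lambda>e. norm (qmoment q \<gamma> e f)) \<in> O(\<lambda>e. q powr (a * real e ^ 2 / 2) * b ^ e)"
    using assms(3,4) by (intro bigoI[of _ C] always_eventually) simp
  then show ?thesis using assms(1-3) unfolding I_omega_def by blast
qed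

end

section \<open>The convolution of two fixed functions\<close>

text \<open>The convolution lives on the lattice of \<open>g\<close>, so the inherited \<gamma>
  belongs to \<open>g\<close> and \<open>\<gamma>\<^sub>0\<close> to \<open>f\<close>;
  \<open>f\<close> enters through its moments.\<close>

locale jackson_convolution = jackson_lattice +
  fixes \<gamma>\<^sub>0 :: real and f g :: "complex \<Rightarrow> complex"
  assumes \<gamma>\<^sub>0_pos: "0 < \<gamma>\<^sub>0" and f: "f \<in> I_omega q \<gamma>\<^sub>0" and g: "g \<in> HD_I_omega q \<gamma>"
begin

sublocale F: jackson_lattice q \<gamma>\<^sub>0
  by unfold_locales (use q_pos q_lt_1 \<gamma>\<^sub>0_pos in auto)

definition cf :: "nat \<Rightarrow> complex" where
  "cf e = (-1) ^ e * qmoment q \<gamma>\<^sub>0 e f / of_real (qfact q e)"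

lemma qconv_term_eq: "qconv_term q \<gamma>\<^sub>0 f g x e = cf e * (qderiv q ^^ e) g x"
  by (simp add: qconv_term_def cf_def)

lemma summable_cf: "B \<ge> 0 \<Longrightarrow> summable (\<lambda>e. norm (cf e) * B ^ e)"
proof (rule summable_comparison_test')
  assume B: "B \<ge> 0"
  then show "summable (\<lambda>e. norm (qmoment q \<gamma>\<^sub>0 e f) * B ^ e)" by (rule F.summable_moments[OF f])
  fix e :: nat
  have "norm (cf e) = norm (qmoment q \<gamma>\<^sub>0 e f) * norm (1 / complex_of_real (qfact q e))"
    by (simp add: cf_def norm_mult norm_divide norm_power)
  also have "\<dots> \<le> norm (qmoment q \<gamma>\<^sub>0 e f) * 1"
    by (intro mult_left_mono qfact_inverse_le q_pos q_lt_1) auto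
  finally show "norm (norm (cf e) * B ^ e) \<le> norm (qmoment q \<gamma>\<^sub>0 e f) * B ^ e"
    using B by (simp add: mult_right_mono)
qed

lemma g_omega: "g \<in> I_omega q \<gamma>"
  using g by (auto simp: HD_I_omega_def I_omega_def)

definition conv_summand :: "nat \<Rightarrow> nat \<Rightarrow> int \<times> real \<Rightarrow> complex" where
  "conv_summand m e p = cf e * (wt p *\<^sub>R ((qderiv q ^^ e) g (pt p) * pt p ^ m))"

lemma norm_conv_summand:
  "p \<in> Lat \<Longrightarrow> norm (conv_summand m e p) = norm (cf e) * (wt p ^ Suc m * norm ((qderiv q ^^ e) g (pt p)))"
  using wt_norm_moment[of p "(qderiv q ^^ e) g" m] by (simp add: conv_summand_def norm_mult)

text \<open>For fixed \<open>m\<close> the weighted norms of the e-th derivative grow at most like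
  \<open>ctrl_factor k0 m ^ e\<close>, which the coefficients \<open>cf e\<close> outweigh.\<close>

lemma conv_summand_summable:
  shows "(\<lambda>p. norm (conv_summand m e p)) summable_on Lat"
    and "summable (\<lambda>e. infsum (\<lambda>p. norm (conv_summand m e p)) Lat)"
proof -
  obtain r k0 h where r: "q powi k0 * \<gamma> < r" and "\<forall>m. \<exists>C. ctrl r k0 m g h C"
    by (rule HD_ctrl[OF g]) (rule that)
  then obtain C where C: "ctrl r k0 m g h C" by blast
  note ce = ctrl_funpow[OF C r]
  show "(\<lambda>p. norm (conv_summand m e p)) summable_on Lat" for e
  proof -
    have "(\<lambda>p. wt p ^ Suc m * norm ((qderiv q ^^ e) g (pt p))) summable_on Lat"
      using ce[of e] unfolding ctrl_def by blast
    from summable_on_cmult_right[OF this, of "norm (cf e)"] show ?thesis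
      by (simp only: norm_conv_summand cong: summable_on_cong)
  qed
  have int: "infsum (\<lambda>p. norm (conv_summand m e p)) Lat = norm (cf e) * amom m ((qderiv q ^^ e) g)" for e
    unfolding amom_def by (simp only: norm_conv_summand infsum_cmult_right' cong: infsum_cong)
  show "summable (\<lambda>e. infsum (\<lambda>p. norm (conv_summand m e p)) Lat)"
  proof (rule summable_comparison_test')
    show "summable (\<lambda>e. C * (norm (cf e) * ctrl_factor k0 m ^ e))"
      by (intro summable_mult summable_cf ctrl_factor_nonneg)
    fix e :: nat
    have "norm (cf e) * amom m ((qderiv q ^^ e) g) \<le> norm (cf e) * (ctrl_factor k0 m ^ e * C)"
      using ce[of e] by (intro mult_left_mono) (auto simp: ctrl_def)
    then show "norm (infsum (\<lambda>p. norm (conv_summand m e p)) Lat) \<le> C * (norm (cf e) * ctrl_factor k0 m ^ e)"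
      unfolding int using amom_nonneg by (simp add: mult_ac)
  qed
qed

text \<open>A by-product of the interchange: at a single atom the summands for m = 0 have the norms
  of the convolution series up to the positive factor \<open>wt p\<close>.\<close>

lemma summable_qconv_term:
  assumes p: "p \<in> Lat"
  shows "summable (\<lambda>e. norm (qconv_term q \<gamma>\<^sub>0 f g (pt p) e))"
proof -
  have "summable (\<lambda>e. norm (conv_summand 0 e p))"
    by (rule series_infsum_summable[OF conv_summand_summable p])
  then have "summable (\<lambda>e. wt p * norm (qconv_term q \<gamma>\<^sub>0 f g (pt p) e))"
    by (simp add: norm_conv_summand[OF p] qconv_term_eq norm_mult mult_ac)
  then show ?thesis by (subst (asm) summable_cmult_iff) simp
qed

lemma qconv_defined: "x \<in> qlattice q \<gamma> \<Longrightarrow> qconv_defined q \<gamma>\<^sub>0 f g x"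
  using summable_qconv_term pt_neq_0 by (auto simp: qlattice_eq qconv_defined_def)

lemma suminf_conv_summand:
  assumes p: "p \<in> Lat"
  shows "suminf (\<lambda>e. conv_summand m e p) = wt p *\<^sub>R (qconv q \<gamma>\<^sub>0 f g (pt p) * pt p ^ m)"
proof -
  have "conv_summand m e p = of_real (wt p) * pt p ^ m * qconv_term q \<gamma>\<^sub>0 f g (pt p) e" for e
    by (simp add: conv_summand_def qconv_term_eq scaleR_conv_of_real mult_ac)
  then show ?thesis
    using suminf_mult[OF summable_norm_cancel[OF summable_qconv_term[OF p]], of "of_real (wt p) * pt p ^ m"]
    by (simp add: qconv_def scaleR_conv_of_real mult_ac)
qed

lemma qconv_inf: "qconv q \<gamma>\<^sub>0 f g \<in> I_inf q \<gamma>"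
  unfolding I_inf_iff
proof
  fix m
  have "(\<lambda>p. norm (suminf (\<lambda>e. conv_summand m e p))) summable_on Lat"
    by (rule series_infsum_abs_summable[OF conv_summand_summable])
  moreover have "norm (suminf (\<lambda>e. conv_summand m e p)) = wt p ^ Suc m * norm (qconv q \<gamma>\<^sub>0 f g (pt p))"
    if "p \<in> Lat" for p
    using wt_norm_moment[OF that, of "qconv q \<gamma>\<^sub>0 f g" m] by (simp add: suminf_conv_summand[OF that])
  ultimately show "(\<lambda>p. wt p ^ Suc m * norm (qconv q \<gamma>\<^sub>0 f g (pt p))) summable_on Lat"
    by (simp only: cong: summable_on_cong)
qed

text \<open>The factors (-1)^e and (1-q)^e of the convolution coefficients cancel those from
  integration by parts. What is left is the q-binomial coefficient, and the terms with e > m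
  vanish.\<close>

lemma qmoment_qconv:
  "qmoment q \<gamma> m (qconv q \<gamma>\<^sub>0 f g) = (\<Sum>e\<le>m. of_real (qpoch q q m / (qpoch q q e * qpoch q q (m - e))) *
     (qmoment q \<gamma>\<^sub>0 e f * qmoment q \<gamma> (m - e) g))"
proof -
  obtain r k0 h where r: "q powi k0 * \<gamma> < r" and ctrl: "\<forall>m. \<exists>C. ctrl r k0 m g h C"
    by (rule HD_ctrl[OF g]) (rule that)
  define w where "w = complex_of_real (q ^ ((m\<^sup>2 + m) div 2)) * of_real (1 - q)"
  have mom: "qmoment q \<gamma> m u = w * infsum (\<lambda>p. wt p *\<^sub>R (u (pt p) * pt p ^ m)) Lat" for u
    by (simp add: w_def qmoment_def jackson_integral_eq scaleR_conv_of_real mult_ac)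
  have "(\<lambda>e. infsum (conv_summand m e) Lat) sums infsum (\<lambda>p. suminf (\<lambda>e. conv_summand m e p)) Lat"
    by (rule series_infsum_swap[OF conv_summand_summable])
  then have "(\<lambda>e. w * infsum (conv_summand m e) Lat) sums
      (w * infsum (\<lambda>p. suminf (\<lambda>e. conv_summand m e p)) Lat)"
    by (rule sums_mult)
  also have "w * infsum (\<lambda>p. suminf (\<lambda>e. conv_summand m e p)) Lat = qmoment q \<gamma> m (qconv q \<gamma>\<^sub>0 f g)"
    unfolding mom by (simp only: suminf_conv_summand cong: infsum_cong)
  also have "(\<lambda>e. w * infsum (conv_summand m e) Lat) = (\<lambda>e. cf e * qmoment q \<gamma> m ((qderiv q ^^ e) g))"
    unfolding mom conv_summand_def[abs_def] infsum_cmult_right' by (simp add: mult_ac)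
  also have "\<dots> = (\<lambda>e. if e \<in> {..m} then of_real (qpoch q q m / (qpoch q q e * qpoch q q (m - e))) *
     (qmoment q \<gamma>\<^sub>0 e f * qmoment q \<gamma> (m - e) g) else 0)"
  proof
    fix e
    show "cf e * qmoment q \<gamma> m ((qderiv q ^^ e) g)
      = (if e \<in> {..m} then of_real (qpoch q q m / (qpoch q q e * qpoch q q (m - e))) *
        (qmoment q \<gamma>\<^sub>0 e f * qmoment q \<gamma> (m - e) g) else 0)"
    proof (cases "e \<le> m")
      case True
      have "(-1) ^ e / qfact q e * ((-1) ^ e * qpoch q q m / (qpoch q q (m - e) * (1 - q) ^ e))
          = ((-1) ^ e * (-1) ^ e) * (qpoch q q m / (qpoch q q e * qpoch q q (m - e)))"
        using q_lt_1 by (simp add: qfact_def)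
      also have "(-1) ^ e * (-1) ^ e = (1 :: real)" by (simp flip: power_add)
      finally have "(-1) ^ e / qfact q e * ((-1) ^ e * qpoch q q m / (qpoch q q (m - e) * (1 - q) ^ e))
          = qpoch q q m / (qpoch q q e * qpoch q q (m - e))" by simp
      from arg_cong[OF this, of complex_of_real]
      have eq: "(-1) ^ e / of_real (qfact q e) *
            of_real ((-1) ^ e * qpoch q q m / (qpoch q q (m - e) * (1 - q) ^ e))
          = complex_of_real (qpoch q q m / (qpoch q q e * qpoch q q (m - e)))"
        by (simp only: of_real_mult of_real_divide of_real_power of_real_minus of_real_1)
      show ?thesis
        using True unfolding qmoment_funpow_qderiv[OF spec[OF ctrl] r] eq[symmetric]
        by (simp add: cf_def)
    qed (simp add: qmoment_funpow_qderiv[OF spec[OF ctrl] r])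
  qed
  finally show ?thesis
    by (rule sums_unique2[OF _ sums_If_finite_set]) simp
qed

lemma qconv_omega: "qconv q \<gamma>\<^sub>0 f g \<in> I_omega q \<gamma>"
proof -
  obtain a1 b1 C1 where 1: "a1 > 0" "b1 > 0" "C1 > 0"
    "\<And>e. norm (qmoment q \<gamma>\<^sub>0 e f) \<le> C1 * (q powr (a1 * real e ^ 2 / 2) * b1 ^ e)"
    using F.I_omega_bound[OF f] by blast
  obtain a2 b2 C2 where 2: "a2 > 0" "b2 > 0" "C2 > 0"
    "\<And>e. norm (qmoment q \<gamma> e g) \<le> C2 * (q powr (a2 * real e ^ 2 / 2) * b2 ^ e)"
    using I_omega_bound[OF g_omega] by blast
  \<comment> \<open>Each of the two inverse q-factorials in the q-binomial coefficient is at most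
    (1/(1-q))^m.\<close>
  define K where "K = (1 / (1 - q))\<^sup>2"
  have K: "K > 0" using q_lt_1 by (simp add: K_def)
  define G where "G m = q powr (min a1 a2 / 2 * real m ^ 2 / 2) * max b1 b2 ^ m" for m
  have G: "G m > 0" for m using 1 2 q_pos by (simp add: G_def)
  have binom: "\<bar>qpoch q q m / (qpoch q q e * qpoch q q (m - e))\<bar> \<le> K ^ m" if "e \<le> m" for m e
  proof -
    have mono: "(1 / (1 - q)) ^ e \<le> (1 / (1 - q)) ^ m" if "e \<le> m" for e
      using that q_pos q_lt_1 by (intro power_increasing) auto
    have inv: "1 / qpoch q q e \<le> (1 / (1 - q)) ^ m" if "e \<le> m" for e
      using inverse_qpoch_le[OF q_pos q_lt_1, of e] mono[OF that] by (rule order_trans)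
    have pos: "qpoch q q k > 0" for k by (rule qpoch_pos[OF q_pos q_lt_1])
    have "qpoch q q m * ((1 / qpoch q q e) * (1 / qpoch q q (m - e)))
        \<le> 1 * ((1 / (1 - q)) ^ m * (1 / (1 - q)) ^ m)"
      using that pos q_lt_1 less_imp_le[OF pos]
      by (intro mult_mono inv qpoch_le_1 q_pos mult_nonneg_nonneg) auto
    also have "\<dots> = K ^ m" by (simp only: K_def power2_eq_square power_mult_distrib mult_1)
    finally show ?thesis using pos[of m] pos[of e] pos[of "m - e"] by simp
  qed
  show ?thesis
  proof (rule I_omegaI[OF qconv_inf])
    fix m
    have "norm (qmoment q \<gamma> m (qconv q \<gamma>\<^sub>0 f g)) \<le> (\<Sum>e\<le>m. K ^ m * (C1 * C2 * G m))"
      unfolding qmoment_qconv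
    proof (rule sum_norm_le)
      fix e assume "e \<in> {..m}"
      then have e: "e \<le> m" by simp
      have "norm (qmoment q \<gamma>\<^sub>0 e f) * norm (qmoment q \<gamma> (m - e) g)
          \<le> (C1 * (q powr (a1 * real e ^ 2 / 2) * b1 ^ e)) * (C2 * (q powr (a2 * real (m - e) ^ 2 / 2) * b2 ^ (m - e)))"
        using 1 2 q_pos by (intro mult_mono 1 2) auto
      also have "\<dots> = C1 * C2 * ((q powr (a1 * real e ^ 2 / 2) * b1 ^ e) * (q powr (a2 * real (m - e) ^ 2 / 2) * b2 ^ (m - e)))"
        by simp
      also have "\<dots> \<le> C1 * C2 * G m"
        unfolding G_def using 1 2 by (intro mult_left_mono gauss_convolution_le q_pos q_lt_1 e) auto
      finally have le: "norm (qmoment q \<gamma>\<^sub>0 e f) * norm (qmoment q \<gamma> (m - e) g) \<le> C1 * C2 * G m" .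
      have "\<bar>qpoch q q m / (qpoch q q e * qpoch q q (m - e))\<bar> *
          (norm (qmoment q \<gamma>\<^sub>0 e f) * norm (qmoment q \<gamma> (m - e) g)) \<le> K ^ m * (C1 * C2 * G m)"
        using K by (intro mult_mono[OF binom[OF e] le]) auto
      then show "norm (of_real (qpoch q q m / (qpoch q q e * qpoch q q (m - e))) *
          (qmoment q \<gamma>\<^sub>0 e f * qmoment q \<gamma> (m - e) g)) \<le> K ^ m * (C1 * C2 * G m)"
        by (simp only: norm_mult norm_of_real)
    qed
    also have "\<dots> = real (Suc m) * (K ^ m * (C1 * C2 * G m))" by simp
    \<comment> \<open>The number of summands, m + 1, is absorbed into the exponential.\<close>
    also have "\<dots> \<le> 2 ^ m * (K ^ m * (C1 * C2 * G m))"
    proof (rule mult_right_mono)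
      have "Suc m \<le> 2 ^ m" by (simp add: Suc_le_eq less_exp)
      then show "real (Suc m) \<le> 2 ^ m" by (metis of_nat_le_iff of_nat_numeral of_nat_power)
      show "0 \<le> K ^ m * (C1 * C2 * G m)" using K 1 2 less_imp_le[OF G[of m]] by simp
    qed
    also have "\<dots> = C1 * C2 * (q powr (min a1 a2 / 2 * real m ^ 2 / 2) * (2 * K * max b1 b2) ^ m)"
      by (simp add: G_def power_mult_distrib mult_ac)
    finally show "norm (qmoment q \<gamma> m (qconv q \<gamma>\<^sub>0 f g))
        \<le> C1 * C2 * (q powr (min a1 a2 / 2 * real m ^ 2 / 2) * (2 * K * max b1 b2) ^ m)" .
  qed (use 1 2 K in auto)
qed

text \<open>The germ of the convolution is obtained by convolving the germ of \<open>g\<close>: its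
  series converges uniformly on the disc that all q-derivatives share.\<close>

lemma qconv_HD: "qconv q \<gamma>\<^sub>0 f g \<in> HD_I_omega q \<gamma>"
proof -
  obtain r k0 h where r: "q powi k0 * \<gamma> < r" and ctrl: "\<forall>m. \<exists>C. ctrl r k0 m g h C"
    by (rule HD_ctrl[OF g]) (rule that)
  then obtain C where C: "ctrl r k0 0 g h C" by blast
  note ce = ctrl_funpow[OF C r]
  define R where "R = q powi k0 * \<gamma>"
  have R: "R > 0" "R < r" using r q_pos \<gamma>_pos by (auto simp: R_def)
  define H where "H z = suminf (\<lambda>e. cf e * (qderiv q ^^ e) h z)" for z
  have "uniform_limit (cball 0 R) (\<lambda>n z. \<Sum>e<n. cf e * (qderiv q ^^ e) h z) H sequentially"
    unfolding H_def[abs_def]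
  proof (rule Weierstrass_m_test)
    show "summable (\<lambda>e. C * (norm (cf e) * ctrl_factor k0 0 ^ e))"
      by (intro summable_mult summable_cf ctrl_factor_nonneg)
    fix e and z :: complex assume "z \<in> cball 0 R"
    then have "norm (cf e) * norm ((qderiv q ^^ e) h z) \<le> norm (cf e) * (ctrl_factor k0 0 ^ e * C)"
      using ce[of e] by (intro mult_left_mono) (auto simp: ctrl_def R_def)
    then show "norm (cf e * (qderiv q ^^ e) h z) \<le> C * (norm (cf e) * ctrl_factor k0 0 ^ e)"
      by (simp add: norm_mult mult_ac)
  qed
  then have lim: "uniform_limit A (\<lambda>n z. \<Sum>e<n. cf e * (qderiv q ^^ e) h z) H sequentially"
    if "A \<subseteq> cball 0 R" for A
    using that by (rule uniform_limit_on_subset)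
  have "H holomorphic_on ball 0 R"
  proof (rule holomorphic_uniform_sequence)
    have "(qderiv q ^^ e) h holomorphic_on ball 0 R" for e
      using ce[of e] R by (auto simp: ctrl_def intro: holomorphic_on_subset)
    then show "(\<lambda>z. \<Sum>e<n. cf e * (qderiv q ^^ e) h z) holomorphic_on ball 0 R" for n
      by (intro holomorphic_intros)
    fix x :: complex assume "x \<in> ball 0 R"
    then obtain d where d: "d > 0" "cball x d \<subseteq> ball 0 R"
      by (meson open_ball open_contains_cball)
    moreover have "cball x d \<subseteq> cball 0 R" using d(2) ball_subset_cball by blast
    ultimately show "\<exists>d>0. cball x d \<subseteq> ball 0 R \<and>
        uniform_limit (cball x d) (\<lambda>n z. \<Sum>e<n. cf e * (qderiv q ^^ e) h z) H sequentially"
      using lim by blast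
  qed simp
  moreover have "qconv q \<gamma>\<^sub>0 f g x = H x" if "x \<in> qlattice q \<gamma> \<inter> ball 0 R" for x
  proof -
    obtain p where p: "p \<in> Lat" "x = pt p" "wt p < R"
      using \<open>x \<in> qlattice q \<gamma> \<inter> ball 0 R\<close> by (auto simp: qlattice_eq norm_pt)
    then have "(qderiv q ^^ e) g x = (qderiv q ^^ e) h x" for e
      using ce[of e] R by (simp add: ctrl_def)
    then show ?thesis by (simp add: qconv_def H_def qconv_term_eq)
  qed
  ultimately show ?thesis using qconv_omega R(1) unfolding HD_I_omega_def by blast
qed

lemma qFourier_series_qconv:
  "qFourier_series q \<gamma> (qconv q \<gamma>\<^sub>0 f g) y = qFourier_series q \<gamma>\<^sub>0 f y * qFourier_series q \<gamma> g y"
proof -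
  have nz: "complex_of_real (qpoch q q k) \<noteq> 0" for k
    using qpoch_pos[OF q_pos q_lt_1, of k] by simp
  have terms: "qFourier_series_term q \<gamma> (qconv q \<gamma>\<^sub>0 f g) y m
      = (\<Sum>e\<le>m. qFourier_series_term q \<gamma>\<^sub>0 f y e * qFourier_series_term q \<gamma> g y (m - e))" for m
    unfolding qFourier_series_term_def qmoment_qconv sum_distrib_right sum_divide_distrib
  proof (rule sum.cong)
    fix e assume "e \<in> {..m}"
    then have "(\<i> * y) ^ m = (\<i> * y) ^ e * (\<i> * y) ^ (m - e)" by (simp flip: power_add)
    then show "of_real (qpoch q q m / (qpoch q q e * qpoch q q (m - e))) *
        (qmoment q \<gamma>\<^sub>0 e f * qmoment q \<gamma> (m - e) g) * (\<i> * y) ^ m / of_real (qpoch q q m)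
      = qmoment q \<gamma>\<^sub>0 e f * (\<i> * y) ^ e / of_real (qpoch q q e) *
        (qmoment q \<gamma> (m - e) g * (\<i> * y) ^ (m - e) / of_real (qpoch q q (m - e)))"
      using nz[of m] nz[of e] nz[of "m - e"] by (simp add: field_simps)
  qed simp
  show ?thesis
    unfolding qFourier_series_def terms[abs_def]
    by (simp add: Cauchy_product[OF F.summable_norm_qFourier_series_term[OF f]
          summable_norm_qFourier_series_term[OF g_omega]])
qed

end

theorem proposition7p1:
  fixes q \<gamma> \<gamma>' :: real
  assumes "0 < q" and "q < 1" and "\<gamma> > 0" and "\<gamma>' > 0"
  shows
    "(\<forall>f \<in> I_omega q \<gamma>.
        (\<forall>y. summable (qFourier_series_term q \<gamma> f y)) \<and>
        qFourier_series q \<gamma> f holomorphic_on UNIV) \<and>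
     (\<forall>f \<in> I_omega q \<gamma> \<inter> I_s_omega q \<gamma>.
        (\<forall>y. jackson_integrable q \<gamma> (qFourier_integrand q f y)) \<and>
        (\<forall>y. qFourier q \<gamma> f y = qFourier_series q \<gamma> f y)) \<and>
     (\<forall>f \<in> I_omega q \<gamma>.
        (\<forall>y. qFourier_series q \<gamma> f y = 0) \<longleftrightarrow> (\<forall>k. qmoment q \<gamma> k f = 0)) \<and>
     (\<forall>f \<in> HS_I_s_omega_half q \<gamma>.
        (\<forall>y. qFourier q \<gamma> f y = 0) \<longleftrightarrow> (\<forall>x \<in> qlattice q \<gamma>. f x = 0)) \<and>
     (\<forall>f \<in> HD_I_omega q \<gamma>. \<forall>g \<in> HD_I_omega q \<gamma>'.
        (\<forall>x \<in> qlattice q \<gamma>'. qconv_defined q \<gamma> f g x) \<and>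
        qconv q \<gamma> f g \<in> HD_I_omega q \<gamma>' \<and>
        (\<forall>y. qFourier_series q \<gamma>' (qconv q \<gamma> f g) y =
             qFourier_series q \<gamma> f y * qFourier_series q \<gamma>' g y))"
proof -
  interpret jackson_lattice q \<gamma> by unfold_locales (use assms in auto)
  have conv: "(\<forall>x \<in> qlattice q \<gamma>'. qconv_defined q \<gamma> f g x) \<and>
        qconv q \<gamma> f g \<in> HD_I_omega q \<gamma>' \<and>
        (\<forall>y. qFourier_series q \<gamma>' (qconv q \<gamma> f g) y =
             qFourier_series q \<gamma> f y * qFourier_series q \<gamma>' g y)"
    if "f \<in> HD_I_omega q \<gamma>" "g \<in> HD_I_omega q \<gamma>'" for f g
  proof -
    interpret C: jackson_convolution q \<gamma>' \<gamma> f g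
      by unfold_locales (use assms that in \<open>auto simp: HD_I_omega_def\<close>)
    show ?thesis by (intro conjI ballI allI C.qconv_defined C.qconv_HD C.qFourier_series_qconv)
  qed
  show ?thesis
    by (intro conjI[OF ballI conjI[OF ballI conjI[OF ballI conjI[OF ballI ballI[OF ballI]]]]] conjI allI
        summable_qFourier_series_term holomorphic_qFourier_series qFourier_eq_series
        qFourier_series_eq_0_iff qFourier_injective conv) auto
qed

end
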